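(* For a partition $\lambda$ and compositions $\alpha,\beta$ where $n=|\lambda|=|\alpha|=|\beta|$: 1. $S^{RS}_\lambda=\sum_{\widetilde\alpha=\lambda}\mathcal S^{RS}_\alpha$. 2. $\mathcal S^{RS}_\alpha=\sum_\beta\beta!\,K_{\alpha\beta}\sum_{\alpha(\Pi)=\beta}\mathbf M_\Pi$, where $K_{\alpha\beta}$ is the number of semistandard composition tableaux $T$ with $sh(T)=\alpha$ and $\mathrm{cont}(T)=\beta$. 3. The $\mathcal S^{RS}_\alpha$ are linearly independent. 4. $\chi(\mathcal S^{RS}_\alpha)=n!\,\mathcal S_\alpha$ and $\tilde\chi(n!\,\mathcal S_\alpha)=\mathcal S^{RS}_\alpha$, where $\chi(\mathbf M_\Pi)=M_{\alpha(\Pi)}$, with right inverse $\tilde\chi(M_\alpha)=\sum_{\alpha(\Pi)=\alpha}\frac{\alpha!}{n!}\mathbf M_\Pi$.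
   Context: A composition is a finite sequence of positive integers; $|\alpha|$ is the sum of its parts, $\widetilde\alpha$ the partition obtained by sorting its parts, and $\alpha!=\alpha_1!\alpha_2!\cdots$. The diagram of $\alpha$ has $\alpha_i$ left-justified cells in row $i$, rows numbered from the top; cells are indexed (row, column). A semistandard reverse tableau (SSRT) of partition shape is a filling by positive integers with rows weakly decreasing left to right and columns strictly decreasing top to bottom. A semistandard composition tableau (SSCT) of shape $\alpha$ is a filling $T$ of the diagram of $\alpha$ by positive integers with rows weakly decreasing left to right, first column strictly increasing top to bottom, and such that if $i<j$, $(i,k)$ and $(j,k+1)$ are cells of $\alpha$ and $T(j,k+1)\le T(i,k)$, then $(i,k+1)$ is a cell of $\alpha$ and $T(j,k+1)<T(i,k+1)$. $sh(T)$ is the shape, and $\mathrm{cont}(T)$ is the weak composition whose $i$-th part is the number of entries equal to $i$ (trailing zeros ignored). The quasisymmetric Schur function is $\mathcal S_\alpha=\sum_{T}\mathbf x^{\mathrm{cont}(T)}$, over SSCT $T$ of shape $\alpha$, in commuting variables $x_1,x_2,\dots$; $M_\alpha$ is the monomial quasisymmetric function. A dotted reverse tableau (resp. dotted composition tableau) $\dot T$ of shape $sh(\dot T)$ is an SSRT (resp. SSCT) of that shape together with dots such that for each $k=1,\dots,n$ ($n$ the number of cells) exactly one entry has $k$ dots above it. $x^{\dot T}$ is the monomial of degree $n$ in noncommuting variables $x_1,x_2,\dots$ with $x_i$ in position $j$ iff $\dot T$ has a cell containing $i$ with $j$ dots. The Schur function in noncommuting variables is $S^{RS}_\lambda=\sum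 x^{\dot T}$ over all dotted reverse tableaux of shape $\lambda$; the quasisymmetric Schur function in noncommuting variables is $\mathcal S^{RS}_\alpha=\sum x^{\dot T}$ over all dotted composition tableaux of shape $\alpha$. A set composition $\Pi=(A_1,\dots,A_\ell)$ of $[n]=\{1,\dots,n\}$ is an ordered family of pairwise disjoint nonempty sets with union $[n]$; $\alpha(\Pi)=(|A_1|,\dots,|A_\ell|)$. $\mathbf M_\Pi=\sum x_{i_1}\cdots x_{i_n}$ (noncommuting variables) over all $(i_1,\dots,i_n)$ such that $i_j=i_k$ iff $j,k$ lie in the same block, and $i_j<i_k$ iff $j\in A_{m_1},k\in A_{m_2}$ with $m_1<m_2$. $NCQSym$ is the span of all $\mathbf M_\Pi$ over all $n\ge0$. $\chi$ is the forgetful map (letting the variables commute), here $\chi:NCQSym\to QSym$, and $\tilde\chi:QSym\to NCQSym$ is linear. *)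

theory Defs
  imports
    Complex_Main
    "HOL-Library.FuncSet"
    "HOL-Library.Multiset"
    "HOL-Library.Function_Algebras"
begin

text \<open>
  A formal power series is its coefficient function. Noncommutative monomials are words
  (\<open>nat list\<close>), commutative monomials are multisets of variable indices (\<open>nat multiset\<close>, where
  \<open>count m i\<close> is the exponent of \<open>x\<^sub>i\<close>). The variables are \<open>x\<^sub>1, x\<^sub>2, \<dots>\<close>; the index \<open>0\<close> never occurs in
  a monomial of the series defined below.
\<close>

definition series_scale :: "'a::field \<Rightarrow> ('m \<Rightarrow> 'a) \<Rightarrow> 'm \<Rightarrow> 'a" where
  "series_scale c f = (\<lambda>m. c * f m)"

global_interpretation series: vector_space "series_scale :: 'a::field \<Rightarrow> ('m \<Rightarrow> 'a) \<Rightarrow> 'm \<Rightarrow> 'a"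
  by unfold_locales (auto simp: series_scale_def fun_eq_iff algebra_simps)

text \<open>The formal sum of the monomials \<open>wt a\<close> over \<open>a \<in> A\<close>; only used when all fibres of \<open>wt\<close> on \<open>A\<close>
  are finite.\<close>

definition gen_series :: "'b set \<Rightarrow> ('b \<Rightarrow> 'm) \<Rightarrow> 'm \<Rightarrow> 'a::field" where
  "gen_series A wt = (\<lambda>m. of_nat (card {a \<in> A. wt a = m}))"


subsection \<open>Compositions, partitions, tableaux\<close>

definition is_composition :: "nat list \<Rightarrow> bool" where
  "is_composition \<alpha> \<longleftrightarrow> (\<forall>a \<in> set \<alpha>. 0 < a)"

definition is_partition :: "nat list \<Rightarrow> bool" where
  "is_partition l \<longleftrightarrow> is_composition l \<and> sorted_wrt (\<ge>) l"

definition underlying_partition :: "nat list \<Rightarrow> nat list" where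
  "underlying_partition \<alpha> = rev (sort \<alpha>)"

definition comp_fact :: "nat list \<Rightarrow> nat" where
  "comp_fact \<alpha> = prod_list (map fact \<alpha>)"

text \<open>Rows (from the top) and columns are numbered from \<open>0\<close>.\<close>

definition diagram :: "nat list \<Rightarrow> (nat \<times> nat) set" where
  "diagram \<alpha> = {(i, k). i < length \<alpha> \<and> k < \<alpha> ! i}"

definition rows_weakly_decreasing :: "nat list \<Rightarrow> (nat \<times> nat \<Rightarrow> nat) \<Rightarrow> bool" where
  "rows_weakly_decreasing \<alpha> T \<longleftrightarrow>
    (\<forall>i k l. k < l \<and> (i, k) \<in> diagram \<alpha> \<and> (i, l) \<in> diagram \<alpha> \<longrightarrow> T (i, l) \<le> T (i, k))"

definition SSRT :: "nat list \<Rightarrow> (nat \<times> nat \<Rightarrow> nat) set" where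
  "SSRT l = {T \<in> diagram l \<rightarrow>\<^sub>E {1..}.
     rows_weakly_decreasing l T \<and>
     (\<forall>i j k. i < j \<and> (i, k) \<in> diagram l \<and> (j, k) \<in> diagram l \<longrightarrow> T (j, k) < T (i, k))}"

definition SSCT :: "nat list \<Rightarrow> (nat \<times> nat \<Rightarrow> nat) set" where
  "SSCT \<alpha> = {T \<in> diagram \<alpha> \<rightarrow>\<^sub>E {1..}.
     rows_weakly_decreasing \<alpha> T \<and>
     (\<forall>i j. i < j \<and> (i, 0) \<in> diagram \<alpha> \<and> (j, 0) \<in> diagram \<alpha> \<longrightarrow> T (i, 0) < T (j, 0)) \<and>
     (\<forall>i j k. i < j \<and> (i, k) \<in> diagram \<alpha> \<and> (j, k + 1) \<in> diagram \<alpha> \<and> T (j, k + 1) \<le> T (i, k) \<longrightarrow>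
        (i, k + 1) \<in> diagram \<alpha> \<and> T (j, k + 1) < T (i, k + 1))}"

definition content :: "nat list \<Rightarrow> (nat \<times> nat \<Rightarrow> nat) \<Rightarrow> nat multiset" where
  "content \<alpha> T = image_mset T (mset_set (diagram \<alpha>))"

text \<open>\<open>K\<^sub>\<alpha>\<^sub>\<beta>\<close>: the entry \<open>i + 1\<close> occurs \<open>\<beta> ! i\<close> times, and entries exceeding the length of
  \<open>\<beta>\<close> do not occur.\<close>

definition K_number :: "nat list \<Rightarrow> nat list \<Rightarrow> nat" where
  "K_number \<alpha> \<beta> = card {T \<in> SSCT \<alpha>.
     \<forall>i. count (content \<alpha> T) (i + 1) = (if i < length \<beta> then \<beta> ! i else 0)}"


subsection \<open>Dotted tableaux\<close>

text \<open>A dotted tableau is a pair \<open>(T, d)\<close>, where \<open>d c\<close> is the number of dots above the entry in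
  cell \<open>c\<close>.\<close>

definition dotted :: "nat list \<Rightarrow> (nat \<times> nat \<Rightarrow> nat) set \<Rightarrow>
    ((nat \<times> nat \<Rightarrow> nat) \<times> (nat \<times> nat \<Rightarrow> nat)) set" where
  "dotted \<alpha> \<T> = {(T, d). T \<in> \<T> \<and> d \<in> extensional (diagram \<alpha>) \<and>
     bij_betw d (diagram \<alpha>) {1..card (diagram \<alpha>)}}"

definition dotted_word ::
    "nat list \<Rightarrow> (nat \<times> nat \<Rightarrow> nat) \<times> (nat \<times> nat \<Rightarrow> nat) \<Rightarrow> nat list" where
  "dotted_word \<alpha> = (\<lambda>(T, d).
     map (\<lambda>j. T (the_inv_into (diagram \<alpha>) d j)) [1..<card (diagram \<alpha>) + 1])"

definition nc_schur :: "nat list \<Rightarrow> nat list \<Rightarrow> 'a::field" where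
  "nc_schur l = gen_series (dotted l (SSRT l)) (dotted_word l)"

definition nc_qschur :: "nat list \<Rightarrow> nat list \<Rightarrow> 'a::field" where
  "nc_qschur \<alpha> = gen_series (dotted \<alpha> (SSCT \<alpha>)) (dotted_word \<alpha>)"


subsection \<open>Quasisymmetric functions in commuting variables\<close>

definition qschur :: "nat list \<Rightarrow> nat multiset \<Rightarrow> 'a::field" where
  "qschur \<alpha> = gen_series (SSCT \<alpha>) (content \<alpha>)"

text \<open>The sum of \<open>x\<^bsub>i\<^sub>1\<^esub>\<^bsup>\<alpha>\<^sub>1\<^esup> \<cdots> x\<^bsub>i\<^sub>l\<^esub>\<^bsup>\<alpha>\<^sub>l\<^esup>\<close> over \<open>1 \<le> i\<^sub>1 < \<dots> < i\<^sub>l\<close>.\<close>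

definition qsym_M :: "nat list \<Rightarrow> nat multiset \<Rightarrow> 'a::field" where
  "qsym_M \<alpha> = gen_series {is. length is = length \<alpha> \<and> sorted_wrt (<) is \<and> set is \<subseteq> {1..}}
     (\<lambda>is. \<Sum>j<length \<alpha>. replicate_mset (\<alpha> ! j) (is ! j))"

definition QSym :: "(nat multiset \<Rightarrow> 'a::field) set" where
  "QSym = series.span (qsym_M ` Collect is_composition)"


subsection \<open>Quasisymmetric functions in noncommuting variables\<close>

definition is_set_composition :: "nat \<Rightarrow> nat set list \<Rightarrow> bool" where
  "is_set_composition n P \<longleftrightarrow>
     (\<forall>m < length P. P ! m \<noteq> {}) \<and>
     (\<forall>m1 < length P. \<forall>m2 < length P. m1 \<noteq> m2 \<longrightarrow> P ! m1 \<inter> P ! m2 = {}) \<and>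
     \<Union> (set P) = {1..n}"

definition block_sizes :: "nat set list \<Rightarrow> nat list" where
  "block_sizes P = map card P"

text \<open>Positions in a word are numbered from \<open>1\<close>, hence the shifts. The length of the words is the
  \<open>n\<close> for which \<open>P\<close> is a set composition of \<open>{1..n}\<close>.\<close>

definition nc_M :: "nat set list \<Rightarrow> nat list \<Rightarrow> 'a::field" where
  "nc_M P = (let n = card (\<Union> (set P)) in
     gen_series {w. length w = n \<and> set w \<subseteq> {1..} \<and>
       (\<forall>j \<in> {1..n}. \<forall>k \<in> {1..n}.
          (w ! (j - 1) = w ! (k - 1) \<longleftrightarrow> (\<exists>A \<in> set P. j \<in> A \<and> k \<in> A)) \<and>
          (w ! (j - 1) < w ! (k - 1) \<longleftrightarrow>
             (\<exists>m1 m2. m1 < m2 \<and> m2 < length P \<and> j \<in> P ! m1 \<and> k \<in> P ! m2)))}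
       (\<lambda>w. w))"

definition NCQSym :: "(nat list \<Rightarrow> 'a::field) set" where
  "NCQSym = series.span {nc_M P |n P. is_set_composition n P}"


subsection \<open>The forgetful map and its right inverse\<close>

text \<open>Letting the variables commute sends the word \<open>w\<close> to \<open>mset w\<close>.\<close>

definition chi :: "(nat list \<Rightarrow> 'a::field) \<Rightarrow> nat multiset \<Rightarrow> 'a" where
  "chi f = (\<lambda>m. \<Sum>w | mset w = m. f w)"

text \<open>The linear map on \<open>QSym\<close> given on the monomial basis. The library's \<open>construct\<close> yields a
  linear map on all series; only its restriction to \<open>QSym\<close> is meaningful.\<close>

definition chi_tilde :: "(nat multiset \<Rightarrow> 'a::field_char_0) \<Rightarrow> nat list \<Rightarrow> 'a" where
  "chi_tilde = vector_space_pair.construct series_scale series_scale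
     (qsym_M ` Collect is_composition)
     (\<lambda>b. let \<alpha> = the_inv_into (Collect is_composition) qsym_M b
          in \<Sum>P | is_set_composition (sum_list \<alpha>) P \<and> block_sizes P = \<alpha>.
               series_scale (of_nat (comp_fact \<alpha>) / fact (sum_list \<alpha>)) (nc_M P))"

end

theory Submission
  imports Defs "HOL-Combinatorics.Multiset_Permutations"
begin

text \<open>
  Everything is compared coefficient by coefficient. Fix a word \<open>w\<close> of length \<open>n\<close> in positive letters,
  and let \<open>\<beta>\<close> be the composition formed by the multiplicities of its letters, the letters being taken
  in increasing order.

  A dotted tableau has the word \<open>w\<close> iff its dots match the positions of \<open>w\<close> with the cells in such a
  way that letters and entries agree. So the entries have content \<open>mset w\<close>, and a tableau with that
  content can be dotted in exactly \<open>\<beta>!\<close> ways, since equal letters may be permuted freely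
  (\<open>gen_series_dotted\<close>). Being an SSCT depends only on the relative order of the entries, so there
  are \<open>K\<^sub>\<alpha>\<^sub>\<beta>\<close> composition tableaux of shape \<open>\<alpha>\<close> with content \<open>mset w\<close> (\<open>card_SSCT_content\<close>). On the other side,
  \<open>w\<close> occurs in exactly one \<open>\<^bold>M\<^sub>\<Pi>\<close>, namely for the set composition \<open>\<Pi>\<close> whose blocks are the
  positions of the successive letters, and then \<open>\<alpha>(\<Pi>) = \<beta>\<close> (\<open>nc_M_apply\<close>). This gives the monomial expansion.

  By the same count the expansion into composition tableaux says that, for each content, there are as many SSRT
  of shape \<open>\<lambda>\<close> as SSCT whose shape rearranges \<open>\<lambda>\<close>. The correspondence is Mason's: forget the order of the
  entries inside each column. Both kinds of tableaux become chains of finite sets in which each set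
  dominates the next, and both can be recovered from the chain. For an SSRT the columns are
  simply sorted. For an SSCT the first column is sorted increasingly, and the triple condition forces
  the position of each entry in the next column: taken from the largest to the smallest, every
  entry goes to the highest free row whose current last entry is not smaller
  (\<open>ex1_next_column\<close>). Column sizes and content are preserved.

  Linear independence is a triangularity of the numbers \<open>K\<^sub>\<alpha>\<^sub>\<beta>\<close>. The first column of a tableau has
  distinct entries, so \<open>\<beta>\<close> is at least as long as \<open>\<alpha>\<close>. If the lengths agree, the first column
  is \<open>1, 2, \<dots>\<close>, and comparing the rows from the last one upwards shows that \<open>\<beta>\<close> precedes \<open>\<alpha>\<close> in
  the lexicographic order read from the right, unless they are equal
  (\<open>K_number_triangular\<close>).

  Finally, \<open>\<chi>\<close> adds the coefficients over all \<open>n!/\<beta>!\<close> rearrangements of \<open>w\<close>, which turns \<open>\<beta>!\<close> into \<open>n!\<close>.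
  The same count shows that there are \<open>n!/\<beta>!\<close> set compositions with block sizes \<open>\<beta>\<close>, so the weights in
  the definition of \<open>\<chi>\<close>'s right inverse add up to one.
\<close>

section \<open>Linear independence of formal series\<close>

lemma sum_fun_apply: "(\<Sum>x\<in>A. f x) y = (\<Sum>x\<in>A. f x y)"
  for f :: "'b \<Rightarrow> 'c \<Rightarrow> 'd::comm_monoid_add"
  by (induction A rule: infinite_finite_induct) auto

text \<open>
  A linear relation between finitely many members of the family is refuted by one monomial that
  occurs in exactly one of them. Since the member may be chosen after the finite set
  \<open>J\<close>, this covers triangular families as well as families with disjoint supports.
\<close>

lemma independent_family_if_separated:
  fixes f :: "'i \<Rightarrow> 'm \<Rightarrow> 'a::field"
  assumes sep: "\<And>J. finite J \<Longrightarrow> J \<noteq> {} \<Longrightarrow> J \<subseteq> I \<Longrightarrow>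
    \<exists>j\<in>J. \<exists>m. f j m \<noteq> 0 \<and> (\<forall>i\<in>J - {j}. f i m = 0)"
  shows "inj_on f I" and "series.independent (f ` I)"
proof -
  show inj: "inj_on f I"
  proof (rule inj_onI, rule ccontr)
    fix x y assume xy: "x \<in> I" "y \<in> I" "f x = f y" "x \<noteq> y"
    then obtain j m
      where j: "j \<in> {x, y}" "f j m \<noteq> 0" "\<forall>i\<in>{x, y} - {j}. f i m = 0"
      using sep[of "{x, y}"] by auto
    \<comment> \<open>The other of the two series has a vanishing coefficient although it equals \<open>f j\<close>.\<close>
    obtain i where "i \<in> {x, y} - {j}" using xy(4) j(1) by auto
    then have "f i m = 0" "f i = f j" using j xy(3) by auto
    then show False using j(2) by simp
  qed
  show "series.independent (f ` I)"
    unfolding series.independent_explicit_finite_subsets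
  proof (intro allI impI)
    fix S u assume S: "S \<subseteq> f ` I" "finite S" and z: "(\<Sum>v\<in>S. series_scale (u v) v) = 0"
    obtain K where K: "K \<subseteq> I" "S = f ` K" "finite K"
      using S finite_subset_image by metis
    define J where "J = {i\<in>K. u (f i) \<noteq> 0}"
    have injK: "inj_on f K" using inj K(1) inj_on_subset by blast
    show "\<forall>v\<in>S. u v = 0"
    proof (rule ccontr)
      assume "\<not> ?thesis"
      then have "J \<noteq> {}" using K by (auto simp: J_def)
      moreover have "finite J" "J \<subseteq> I" using K by (auto simp: J_def)
      ultimately obtain j m where j: "j \<in> J" "f j m \<noteq> 0" "\<forall>i\<in>J - {j}. f i m = 0"
        using sep[of J] by auto
      have "0 = (\<Sum>v\<in>S. series_scale (u v) v) m" using z by simp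
      also have "\<dots> = (\<Sum>v\<in>S. u v * v m)" by (simp add: sum_fun_apply series_scale_def)
      also have "\<dots> = (\<Sum>i\<in>K. u (f i) * f i m)"
        unfolding K(2) by (simp add: sum.reindex injK)
      also have "\<dots> = (\<Sum>i\<in>{j}. u (f i) * f i m)"
        by (rule sum.mono_neutral_right) (use K j in \<open>auto simp: J_def\<close>)
      finally show False using j by (simp add: J_def)
    qed
  qed
qed

section \<open>Commutative monomials and their exponent compositions\<close>

definition mset_support :: "nat multiset \<Rightarrow> nat list" where
  "mset_support m = sorted_list_of_set (set_mset m)"

text \<open>
  For the monomial \<open>x\<^bsub>i\<^sub>1\<^esub>\<^bsup>\<alpha>\<^sub>1\<^esup> \<cdots>
  x\<^bsub>i\<^sub>l\<^esub>\<^bsup>\<alpha>\<^sub>l\<^esup>\<close> with \<open>i\<^sub>1 <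
  \<dots> < i\<^sub>l\<close> and positive exponents, this is \<open>\<alpha>\<close>. For a
  series of bounded degree, quasisymmetry means that the coefficients depend on it alone.
\<close>

definition mset_composition :: "nat multiset \<Rightarrow> nat list" where
  "mset_composition m = map (count m) (mset_support m)"

text \<open>
  The inverse of \<open>m \<mapsto> (mset_composition m, mset_support m)\<close>, in the form in
  which \<open>qsym_M\<close> writes its monomials.
\<close>

definition weighted_mset :: "nat list \<Rightarrow> nat list \<Rightarrow> nat multiset" where
  "weighted_mset \<beta> xs = (\<Sum>j<length \<beta>. replicate_mset (\<beta> ! j) (xs ! j))"

lemma count_weighted_mset:
  "count (weighted_mset \<beta> xs) v = (\<Sum>j<length \<beta>. if xs ! j = v then \<beta> ! j else 0)"
  unfolding weighted_mset_def count_sum by (intro sum.cong) auto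

lemma count_weighted_mset_nth:
  assumes "distinct xs" "length xs = length \<beta>" "j < length \<beta>"
  shows "count (weighted_mset \<beta> xs) (xs ! j) = \<beta> ! j"
proof -
  have "count (weighted_mset \<beta> xs) (xs ! j) = (\<Sum>i<length \<beta>. if i = j then \<beta> ! i else 0)"
    unfolding count_weighted_mset
    by (intro sum.cong) (use assms in \<open>auto simp: nth_eq_iff_index_eq\<close>)
  then show ?thesis using assms by simp
qed

lemma set_weighted_mset:
  assumes "is_composition \<beta>" "length xs = length \<beta>"
  shows "set_mset (weighted_mset \<beta> xs) = set xs"
proof (intro set_eqI iffI)
  fix v assume "v \<in># weighted_mset \<beta> xs"
  then have "(\<Sum>j<length \<beta>. if xs ! j = v then \<beta> ! j else 0) \<noteq> 0"
    by (simp flip: count_weighted_mset)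
  then obtain j where "j < length \<beta>" "xs ! j = v"
    by (auto simp: sum_eq_0_iff split: if_splits)
  then show "v \<in> set xs" using assms by auto
next
  fix v assume "v \<in> set xs"
  then obtain j where j: "j < length \<beta>" "xs ! j = v" using assms by (metis in_set_conv_nth)
  then have "0 < \<beta> ! j" using assms by (auto simp: is_composition_def)
  then have "0 < count (weighted_mset \<beta> xs) v"
    unfolding count_weighted_mset by (intro sum_pos2[of _ j]) (use j in auto)
  then show "v \<in># weighted_mset \<beta> xs" by simp
qed

lemma mset_support_weighted_mset:
  assumes "is_composition \<beta>" "length xs = length \<beta>" "sorted_wrt (<) xs"
  shows "mset_support (weighted_mset \<beta> xs) = xs"
  unfolding mset_support_def set_weighted_mset[OF assms(1,2)]
  using assms(3) by (simp add: strict_sorted_iff sorted_list_of_set.idem_if_sorted_distinct)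

lemma mset_composition_weighted_mset:
  assumes "is_composition \<beta>" "length xs = length \<beta>" "sorted_wrt (<) xs"
  shows "mset_composition (weighted_mset \<beta> xs) = \<beta>"
  unfolding mset_composition_def mset_support_weighted_mset[OF assms]
  by (rule nth_equalityI)
    (use assms count_weighted_mset_nth in \<open>auto simp: strict_sorted_iff\<close>)

lemma set_mset_support [simp]: "set (mset_support m) = set_mset m"
  by (simp add: mset_support_def)

lemma sorted_mset_support: "sorted_wrt (<) (mset_support m)"
  by (simp add: mset_support_def)

lemma length_mset_composition [simp]: "length (mset_composition m) = length (mset_support m)"
  by (simp add: mset_composition_def)

lemma is_composition_mset_composition: "is_composition (mset_composition m)"
  by (auto simp: is_composition_def mset_composition_def)

lemma sum_list_mset_composition: "sum_list (mset_composition m) = size m"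
  unfolding mset_composition_def mset_support_def
  by (simp add: sum_list_distinct_conv_sum_set size_multiset_overloaded_eq)

lemma weighted_mset_composition: "weighted_mset (mset_composition m) (mset_support m) = m"
proof (rule multiset_eqI)
  fix v
  have d: "distinct (mset_support m)" by (simp add: mset_support_def)
  show "count (weighted_mset (mset_composition m) (mset_support m)) v = count m v"
  proof (cases "v \<in># m")
    case True
    then obtain j where "j < length (mset_support m)" "mset_support m ! j = v"
      by (metis in_set_conv_nth set_mset_support)
    then show ?thesis using count_weighted_mset_nth[OF d, of "mset_composition m" j]
      by (auto simp: mset_composition_def)
  next
    case False
    then show ?thesis
      by (metis count_eq_zero_iff is_composition_mset_composition length_mset_composition
          set_mset_support set_weighted_mset)
  qed
qed

lemma size_weighted_mset: "size (weighted_mset \<beta> xs) = sum_list \<beta>"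
  unfolding weighted_mset_def by (simp add: size_multiset_sum sum_list_sum_nth atLeast0LessThan)

text \<open>
  A monomial determines the increasing index sequence that produces it, so it occurs at most once
  in \<open>M\<^sub>\<beta>\<close>.
\<close>

lemma qsym_M_apply:
  assumes "is_composition \<beta>"
  shows "(qsym_M \<beta> m :: 'a::field) = (if 0 \<notin># m \<and> mset_composition m = \<beta> then 1 else 0)"
proof -
  let ?A = "{a \<in> {is. length is = length \<beta> \<and> sorted_wrt (<) is \<and> set is \<subseteq> {1..}}.
    weighted_mset \<beta> a = m}"
  have "?A = (if 0 \<notin># m \<and> mset_composition m = \<beta> then {mset_support m} else {})"
  proof (cases "0 \<notin># m \<and> mset_composition m = \<beta>")
    case True
    then have "mset_support m \<in> ?A"
      using sorted_mset_support[of m] weighted_mset_composition[of m]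
      by (auto simp: Suc_le_eq intro: gr0I)
    moreover have "a = mset_support m" if "a \<in> ?A" for a
      using that mset_support_weighted_mset[OF assms, of a] by auto
    ultimately have "?A = {mset_support m}" by blast
    then show ?thesis using True by simp
  next
    case False
    have "False" if "a \<in> ?A" for a
    proof -
      have "mset_composition m = \<beta>" "set_mset m = set a"
        using that mset_composition_weighted_mset[OF assms] set_weighted_mset[OF assms]
        by auto
      then show False using that False by auto
    qed
    then show ?thesis using False by auto
  qed
  then have "card ?A = (if 0 \<notin># m \<and> mset_composition m = \<beta> then 1 else 0)" by auto
  then show ?thesis
    unfolding qsym_M_def gen_series_def weighted_mset_def by auto
qed

text \<open>
  The monomial \<open>x\<^sub>1\<^bsup>\<beta>\<^sub>1\<^esup>
  x\<^sub>2\<^bsup>\<beta>\<^sub>2\<^esup> \<cdots>\<close>.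
\<close>

definition standard_mset :: "nat list \<Rightarrow> nat multiset" where
  "standard_mset \<beta> = weighted_mset \<beta> [1..<Suc (length \<beta>)]"

lemma standard_mset_properties:
  assumes "is_composition \<beta>"
  shows "0 \<notin># standard_mset \<beta>" "mset_composition (standard_mset \<beta>) = \<beta>"
    "set_mset (standard_mset \<beta>) = {1..length \<beta>}"
    "mset_support (standard_mset \<beta>) = [1..<Suc (length \<beta>)]"
  unfolding standard_mset_def
  by (auto simp del: upt_Suc simp: set_weighted_mset[OF assms] mset_composition_weighted_mset[OF assms]
    mset_support_weighted_mset[OF assms])

text \<open>
  Distinct \<open>M\<^sub>\<beta>\<close> have disjoint supports.
\<close>

lemma qsym_M_independent:
  "inj_on (qsym_M :: nat list \<Rightarrow> _ \<Rightarrow> 'a::field) (Collect is_composition)"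
  "series.independent ((qsym_M :: nat list \<Rightarrow> _ \<Rightarrow> 'a::field) ` Collect is_composition)"
proof -
  have "\<exists>j\<in>J. \<exists>m. (qsym_M j m :: 'a) \<noteq> 0 \<and> (\<forall>i\<in>J - {j}. (qsym_M i m :: 'a) = 0)"
    if J: "J \<noteq> {}" "J \<subseteq> Collect is_composition" for J
  proof -
    obtain \<beta> where b: "\<beta> \<in> J" "is_composition \<beta>" using J by auto
    show ?thesis
    proof (intro bexI[of _ \<beta>] exI[of _ "standard_mset \<beta>"] conjI ballI)
      show "(qsym_M \<beta> (standard_mset \<beta>) :: 'a) \<noteq> 0"
        using b standard_mset_properties[of \<beta>] by (simp add: qsym_M_apply)
      fix \<gamma> assume "\<gamma> \<in> J - {\<beta>}"
      then show "(qsym_M \<gamma> (standard_mset \<beta>) :: 'a) = 0"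
        using b J standard_mset_properties[of \<beta>] by (subst qsym_M_apply) auto
    qed (use b in auto)
  qed
  then show "inj_on (qsym_M :: nat list \<Rightarrow> _ \<Rightarrow> 'a::field) (Collect is_composition)"
    "series.independent ((qsym_M :: nat list \<Rightarrow> _ \<Rightarrow> 'a::field) ` Collect is_composition)"
    using independent_family_if_separated[of "Collect is_composition" "qsym_M :: nat list \<Rightarrow> _ \<Rightarrow> 'a"]
    by simp_all
qed

section \<open>Words and set compositions\<close>

text \<open>
  The set composition \<open>\<Pi>\<close> for which the word occurs in
  \<open>\<^bold>M\<^sub>\<Pi>\<close>. As there, positions are counted from \<open>1\<close>.
\<close>

definition ordered_blocks :: "nat list \<Rightarrow> nat set list" where
  "ordered_blocks w = map (\<lambda>v. {j \<in> {1..length w}. w ! (j - 1) = v}) (mset_support (mset w))"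

lemma card_positions: "card {j \<in> {1..length w}. w ! (j - 1) = v} = count (mset w) v"
proof -
  have "{j \<in> {1..length w}. w ! (j - 1) = v} = Suc ` {i. i < length w \<and> v = w ! i}"
  proof (intro set_eqI iffI)
    fix j assume "j \<in> {j \<in> {1..length w}. w ! (j - 1) = v}"
    then show "j \<in> Suc ` {i. i < length w \<and> v = w ! i}"
      by (intro image_eqI[of _ _ "j - 1"]) auto
  qed auto
  then show ?thesis
    by (simp only: card_image[OF inj_on_subset[OF inj_Suc subset_UNIV]] count_mset
        count_list_eq_length_filter length_filter_conv_card)
qed

lemma length_ordered_blocks [simp]: "length (ordered_blocks w) = length (mset_support (mset w))"
  by (simp add: ordered_blocks_def)

lemma nth_ordered_blocks:
  "k < length (mset_support (mset w)) \<Longrightarrow>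
    ordered_blocks w ! k = {j \<in> {1..length w}. w ! (j - 1) = mset_support (mset w) ! k}"
  by (simp add: ordered_blocks_def)

lemma distinct_mset_support: "distinct (mset_support m)"
  by (simp add: mset_support_def)

lemma mset_support_eqI: "sorted_wrt (<) xs \<Longrightarrow> set xs = set_mset m \<Longrightarrow> mset_support m = xs"
  unfolding mset_support_def
  by (metis sorted_list_of_set.idem_if_sorted_distinct strict_sorted_iff)

lemma position_in_block:
  assumes "j \<in> {1..length w}"
  obtains k where "k < length (mset_support (mset w))" "w ! (j - 1) = mset_support (mset w) ! k"
proof -
  have "w ! (j - 1) \<in> set w" using assms by (intro nth_mem) auto
  then have "w ! (j - 1) \<in> set (mset_support (mset w))" by simp
  then show ?thesis using that by (metis in_set_conv_nth)
qed

lemma is_set_composition_ordered_blocks: "is_set_composition (length w) (ordered_blocks w)"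
  unfolding is_set_composition_def
proof (intro conjI allI impI)
  let ?vs = "mset_support (mset w)"
  fix k assume k: "k < length (ordered_blocks w)"
  then have "?vs ! k \<in> set w"
    using nth_mem[of k ?vs] by simp
  then obtain i where "i < length w" "w ! i = ?vs ! k" by (metis in_set_conv_nth)
  then have "Suc i \<in> ordered_blocks w ! k" using k by (simp add: nth_ordered_blocks)
  then show "ordered_blocks w ! k \<noteq> {}" by auto
next
  fix k l assume "k < length (ordered_blocks w)" "l < length (ordered_blocks w)" "k \<noteq> l"
  then show "ordered_blocks w ! k \<inter> ordered_blocks w ! l = {}"
    using distinct_mset_support[of "mset w"] by (auto simp: nth_ordered_blocks nth_eq_iff_index_eq)
next
  show "\<Union> (set (ordered_blocks w)) = {1..length w}"
  proof (intro set_eqI iffI)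
    fix j assume j: "j \<in> {1..length w}"
    obtain k where "k < length (mset_support (mset w))" "w ! (j - 1) = mset_support (mset w) ! k"
      using position_in_block[OF j] .
    then have "k < length (ordered_blocks w)" "j \<in> ordered_blocks w ! k"
      using j by (auto simp: nth_ordered_blocks)
    then show "j \<in> \<Union> (set (ordered_blocks w))" by (meson UnionI nth_mem)
  qed (auto simp: ordered_blocks_def)
qed

lemma block_sizes_ordered_blocks: "block_sizes (ordered_blocks w) = mset_composition (mset w)"
  unfolding block_sizes_def ordered_blocks_def mset_composition_def map_map comp_def card_positions ..

lemma set_composition_block_of:
  assumes "is_set_composition n P" "j \<in> {1..n}"
  obtains k where "k < length P" "j \<in> P ! k"
  using assms unfolding is_set_composition_def by (metis UnionE in_set_conv_nth)

lemma set_composition_block_unique: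
  assumes "is_set_composition n P" "k < length P" "l < length P" "j \<in> P ! k" "j \<in> P ! l"
  shows "k = l"
  using assms unfolding is_set_composition_def by (metis IntI empty_iff)

lemma set_composition_block_subset:
  assumes "is_set_composition n P" "k < length P"
  shows "P ! k \<subseteq> {1..n}"
  using assms unfolding is_set_composition_def by (metis Union_upper nth_mem)

lemma set_composition_block_nonempty:
  assumes "is_set_composition n P" "k < length P"
  shows "P ! k \<noteq> {}"
  using assms unfolding is_set_composition_def by blast

text \<open>
  Recovers a word from its set composition \<open>P\<close> and the increasing list
  \<open>vs\<close> of its letters.
\<close>

definition word_of_blocks :: "nat \<Rightarrow> nat set list \<Rightarrow> nat list \<Rightarrow> nat list" where
  "word_of_blocks n P vs = map (\<lambda>i. vs ! (THE k. k < length P \<and> Suc i \<in> P ! k)) [0..<n]"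

lemma length_word_of_blocks [simp]: "length (word_of_blocks n P vs) = n"
  by (simp add: word_of_blocks_def)

lemma word_of_blocks_nth:
  assumes P: "is_set_composition n P" and "k < length P" "j \<in> P ! k"
  shows "word_of_blocks n P vs ! (j - 1) = vs ! k"
proof -
  have j: "j \<in> {1..n}" using set_composition_block_subset[OF P] assms by blast
  have "(THE k. k < length P \<and> Suc (j - 1) \<in> P ! k) = k"
    using assms j set_composition_block_unique[OF P] by (intro the_equality) auto
  then show ?thesis using j by (auto simp: word_of_blocks_def)
qed

text \<open>
  The blocks are nonempty and cover all positions, so the letters of \<open>w\<close> are exactly
  those in \<open>vs\<close>. As \<open>vs\<close> is strictly increasing, different blocks carry
  different letters, in the right order.
\<close>

lemma ordered_blocks_eqI:
  assumes P: "is_set_composition n P" and "length w = n" and vs: "sorted_wrt (<) vs"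
    and len: "length vs = length P"
    and eq: "\<And>k j. k < length P \<Longrightarrow> j \<in> P ! k \<Longrightarrow> w ! (j - 1) = vs ! k"
  shows "mset_support (mset w) = vs" "ordered_blocks w = P"
proof -
  have "set vs = set w"
  proof (intro set_eqI iffI)
    fix v assume "v \<in> set vs"
    then obtain k where k: "k < length P" "v = vs ! k" using len by (metis in_set_conv_nth)
    then obtain j where j: "j \<in> P ! k" using set_composition_block_nonempty[OF P] by blast
    then have "j \<in> {1..n}" using set_composition_block_subset[OF P] k by blast
    then show "v \<in> set w" using eq[OF k(1) j] k(2) \<open>length w = n\<close>
      by (metis One_nat_def Suc_pred' atLeastAtMost_iff less_eq_Suc_le nth_mem)
  next
    fix v assume "v \<in> set w"
    then obtain i where i: "i < n" "v = w ! i" using \<open>length w = n\<close> by (metis in_set_conv_nth)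
    then obtain k where k: "k < length P" "Suc i \<in> P ! k"
      using set_composition_block_of[OF P, of "Suc i"] by auto
    then show "v \<in> set vs" using eq[OF k] i len by auto
  qed
  then show sup: "mset_support (mset w) = vs" using vs by (intro mset_support_eqI) auto
  show "ordered_blocks w = P"
  proof (rule nth_equalityI)
    show "length (ordered_blocks w) = length P" using sup len by simp
    fix k assume "k < length (ordered_blocks w)"
    then have k: "k < length vs" "k < length P" using sup len by simp_all
    have "distinct vs" using vs by (simp add: strict_sorted_iff)
    have "{j \<in> {1..n}. w ! (j - 1) = vs ! k} = P ! k"
    proof (intro set_eqI iffI)
      fix j assume j: "j \<in> {j \<in> {1..n}. w ! (j - 1) = vs ! k}"
      then obtain l where l: "l < length P" "j \<in> P ! l"
        using set_composition_block_of[OF P, of j] by blast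
      then have "vs ! l = vs ! k" using eq[OF l] j by simp
      then have "l = k" using \<open>distinct vs\<close> l(1) k len by (simp add: nth_eq_iff_index_eq)
      then show "j \<in> P ! k" using l by simp
    next
      fix j assume "j \<in> P ! k"
      then show "j \<in> {j \<in> {1..n}. w ! (j - 1) = vs ! k}"
        using eq[OF k(2)] set_composition_block_subset[OF P k(2)] by blast
    qed
    then show "ordered_blocks w ! k = P ! k"
      using k sup \<open>length w = n\<close> by (simp add: nth_ordered_blocks)
  qed
qed

text \<open>
  The two conditions defining \<open>\<^bold>M\<^sub>\<Pi>\<close> say exactly that
  \<open>\<Pi>\<close> is the set composition of the word. So each word of positive letters occurs
  in one \<open>\<^bold>M\<^sub>\<Pi>\<close> only, with coefficient one.
\<close>

lemma nc_M_apply: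
  assumes P: "is_set_composition n P"
  shows "(nc_M P w :: 'a::field) =
    (if length w = n \<and> 0 \<notin> set w \<and> ordered_blocks w = P then 1 else 0)"
proof -
  let ?C = "\<lambda>w. length w = n \<and> set w \<subseteq> {1..} \<and>
       (\<forall>j \<in> {1..n}. \<forall>k \<in> {1..n}.
          (w ! (j - 1) = w ! (k - 1) \<longleftrightarrow> (\<exists>A \<in> set P. j \<in> A \<and> k \<in> A)) \<and>
          (w ! (j - 1) < w ! (k - 1) \<longleftrightarrow>
             (\<exists>m1 m2. m1 < m2 \<and> m2 < length P \<and> j \<in> P ! m1 \<and> k \<in> P ! m2)))"
  have pos: "set w \<subseteq> {1..} \<longleftrightarrow> 0 \<notin> set w" by (auto simp: Suc_le_eq intro: gr0I)
  have iff: "?C w \<longleftrightarrow> length w = n \<and> 0 \<notin> set w \<and> ordered_blocks w = P"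
  proof (intro iffI)
    assume C: "?C w"
    \<comment> \<open>The letter written on a block is read off at a representative \<open>r k\<close> of the block.\<close>
    define r where "r k = (SOME j. j \<in> P ! k)" for k
    have r: "r k \<in> P ! k" if "k < length P" for k
      using set_composition_block_nonempty[OF P that] unfolding r_def by (simp add: some_in_eq)
    have rn: "r k \<in> {1..n}" if "k < length P" for k
      using r[OF that] set_composition_block_subset[OF P that] by blast
    define vs where "vs = map (\<lambda>k. w ! (r k - 1)) [0..<length P]"
    have "ordered_blocks w = P"
    proof (rule ordered_blocks_eqI(2)[OF P])
      show "length w = n" using C by blast
      show "length vs = length P" by (simp add: vs_def)
      show "sorted_wrt (<) vs"
        unfolding sorted_wrt_iff_nth_less
      proof (intro allI impI)
        fix i j assume "i < j" "j < length vs"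
        then have ij: "i < j" "j < length P" "i < length P" by (auto simp: vs_def)
        then have "w ! (r i - 1) < w ! (r j - 1)"
          using C rn[OF ij(2)] rn[OF ij(3)] r[OF ij(2)] r[OF ij(3)] by blast
        then show "vs ! i < vs ! j" using ij by (simp add: vs_def)
      qed
      fix k j assume k: "k < length P" and j: "j \<in> P ! k"
      have "j \<in> {1..n}" using j set_composition_block_subset[OF P k] by blast
      then have "w ! (j - 1) = w ! (r k - 1)"
        using C rn[OF k] r[OF k] j nth_mem[OF k] by blast
      then show "w ! (j - 1) = vs ! k" using k by (simp add: vs_def)
    qed
    then show "length w = n \<and> 0 \<notin> set w \<and> ordered_blocks w = P" using C pos by blast
  next
    assume R: "length w = n \<and> 0 \<notin> set w \<and> ordered_blocks w = P"
    define vs where "vs = mset_support (mset w)"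
    have len: "length P = length vs" using R by (auto simp: vs_def)
    have mem: "j \<in> P ! k \<longleftrightarrow> w ! (j - 1) = vs ! k" if "j \<in> {1..n}" "k < length vs" for j k
    proof -
      have "ordered_blocks w ! k = {j \<in> {1..length w}. w ! (j - 1) = vs ! k}"
        unfolding vs_def by (rule nth_ordered_blocks) (use that vs_def in simp)
      then show ?thesis using R that by auto
    qed
    have ex: "\<exists>k<length vs. w ! (j - 1) = vs ! k" if "j \<in> {1..n}" for j
      using position_in_block[of j w] that R unfolding vs_def by metis
    have srt: "sorted_wrt (<) vs" unfolding vs_def by (rule sorted_mset_support)
    have "(w ! (j - 1) = w ! (k - 1) \<longleftrightarrow> (\<exists>A \<in> set P. j \<in> A \<and> k \<in> A)) \<and>
          (w ! (j - 1) < w ! (k - 1) \<longleftrightarrow>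
             (\<exists>m1 m2. m1 < m2 \<and> m2 < length P \<and> j \<in> P ! m1 \<and> k \<in> P ! m2))"
      if j: "j \<in> {1..n}" and k: "k \<in> {1..n}" for j k
    proof -
      obtain a where a: "a < length vs" "w ! (j - 1) = vs ! a" using ex[OF j] by blast
      obtain b where b: "b < length vs" "w ! (k - 1) = vs ! b" using ex[OF k] by blast
      have lt: "vs ! x < vs ! y \<longleftrightarrow> x < y" if "x < length vs" "y < length vs" for x y
        using srt that unfolding sorted_wrt_iff_nth_less
        by (metis linorder_neqE_nat order_less_asym order_less_irrefl)
      have eq: "vs ! x = vs ! y \<longleftrightarrow> x = y" if "x < length vs" "y < length vs" for x y
        using lt[OF that] lt[OF that(2,1)] by auto
      have ja: "j \<in> P ! x \<longleftrightarrow> x = a" if "x < length vs" for x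
        using mem[OF j that] a eq[OF a(1) that] by auto
      have kb: "k \<in> P ! x \<longleftrightarrow> x = b" if "x < length vs" for x
        using mem[OF k that] b eq[OF b(1) that] by auto
      have "(\<exists>A \<in> set P. j \<in> A \<and> k \<in> A) \<longleftrightarrow> (\<exists>x<length vs. j \<in> P ! x \<and> k \<in> P ! x)"
        using len by (metis in_set_conv_nth)
      also have "\<dots> \<longleftrightarrow> a = b" using ja kb a(1) by auto
      finally have 1: "(\<exists>A \<in> set P. j \<in> A \<and> k \<in> A) \<longleftrightarrow> a = b" .
      have 2: "(\<exists>m1 m2. m1 < m2 \<and> m2 < length P \<and> j \<in> P ! m1 \<and> k \<in> P ! m2) \<longleftrightarrow> a < b"
        using ja kb b(1) len by (metis order_less_trans)
      show ?thesis unfolding 1 2 a(2) b(2) using lt[OF a(1) b(1)] eq[OF a(1) b(1)] by simp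
    qed
    then show "?C w" using R pos by blast
  qed
  have "card (\<Union> (set P)) = n" using P unfolding is_set_composition_def by auto
  then have "nc_M P w = (of_nat (card {a \<in> {w. ?C w}. a = w}) :: 'a)"
    unfolding nc_M_def gen_series_def by (simp only: Let_def)
  also have "{a \<in> {w. ?C w}. a = w} = (if ?C w then {w} else {})" by auto
  finally show ?thesis unfolding iff by auto
qed

text \<open>
  Given the set composition, the word amounts to the increasing list of its letters, and
  \<open>m\<close> supplies that list. The hypothesis on \<open>m\<close> makes the multiplicities
  come out right.
\<close>

lemma ex1_word_with_blocks:
  assumes P: "is_set_composition n P" and m: "mset_composition m = block_sizes P"
  shows "\<exists>!w. mset w = m \<and> length w = n \<and> ordered_blocks w = P"
proof -
  let ?vs = "mset_support m" and ?w = "word_of_blocks n P (mset_support m)"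
  have len: "length ?vs = length P"
    using arg_cong[OF m, of length] by (simp add: block_sizes_def)
  have "mset_support (mset ?w) = ?vs" and b: "ordered_blocks ?w = P"
    using ordered_blocks_eqI[OF P _ sorted_mset_support len, of ?w] word_of_blocks_nth[OF P]
    by auto
  then have "mset ?w = weighted_mset (mset_composition m) ?vs"
    using weighted_mset_composition[of "mset ?w"] block_sizes_ordered_blocks[of ?w] m by simp
  then have w: "mset ?w = m" by (simp add: weighted_mset_composition)
  have uniq: "w = ?w" if w': "mset w = m" "length w = n" "ordered_blocks w = P" for w
  proof (rule nth_equalityI)
    show "length w = length ?w" using w' by simp
    fix i assume "i < length w"
    then obtain k where k: "k < length P" "Suc i \<in> P ! k"
      using set_composition_block_of[OF P, of "Suc i"] w' by auto
    then have "w ! (Suc i - 1) = ?vs ! k"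
      using nth_ordered_blocks[of k w] w' len by auto
    then show "w ! i = ?w ! i" using word_of_blocks_nth[OF P k, of ?vs] by simp
  qed
  show ?thesis
  proof (rule ex1I)
    show "mset ?w = m \<and> length ?w = n \<and> ordered_blocks ?w = P" using w b by simp
    show "w = ?w" if "mset w = m \<and> length w = n \<and> ordered_blocks w = P" for w
      using uniq that by blast
  qed
qed

lemma is_composition_block_sizes:
  assumes P: "is_set_composition n P"
  shows "is_composition (block_sizes P)"
  unfolding is_composition_def block_sizes_def
proof
  fix a assume "a \<in> set (map card P)"
  then obtain k where "k < length P" "a = card (P ! k)" by (metis in_set_conv_nth length_map nth_map)
  then show "0 < a"
    using set_composition_block_nonempty[OF P] set_composition_block_subset[OF P]
    by (metis card_gt_0_iff finite_atLeastAtMost finite_subset)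
qed

lemma finite_words_of_mset: "finite {w. mset w = m}"
  using finite_permutations_of_multiset[of m] by (simp add: permutations_of_multiset_def)

text \<open>
  Each monomial of \<open>M\<^bsub>\<alpha>(\<Pi>)\<^esub>\<close> is the commutative image of
  exactly one word in \<open>\<^bold>M\<^sub>\<Pi>\<close>, by
  \<open>ex1_word_with_blocks\<close>.
\<close>

lemma chi_nc_M:
  assumes P: "is_set_composition n P"
  shows "chi (nc_M P) = (qsym_M (block_sizes P) :: _ \<Rightarrow> 'a::field)"
proof
  fix m
  let ?S = "{w. mset w = m \<and> length w = n \<and> 0 \<notin> set w \<and> ordered_blocks w = P}"
  have "chi (nc_M P) m = (\<Sum>w | mset w = m.
      if length w = n \<and> 0 \<notin> set w \<and> ordered_blocks w = P then 1 else (0::'a))"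
    unfolding chi_def by (simp add: nc_M_apply[OF P])
  also have "\<dots> = (\<Sum>w\<in>?S. 1)"
    by (rule sum.mono_neutral_cong_right) (auto simp: finite_words_of_mset)
  also have "\<dots> = (if 0 \<notin># m \<and> mset_composition m = block_sizes P then 1 else 0)"
  proof (cases "0 \<notin># m \<and> mset_composition m = block_sizes P")
    case True
    then have "\<exists>!w. mset w = m \<and> length w = n \<and> ordered_blocks w = P"
      using ex1_word_with_blocks[OF P] by blast
    then obtain w where "{w. mset w = m \<and> length w = n \<and> ordered_blocks w = P} = {w}" by blast
    moreover have "?S = {w. mset w = m \<and> length w = n \<and> ordered_blocks w = P}" using True by auto
    ultimately have "?S = {w}" by simp
    then show ?thesis using True by simp
  next
    case False
    then have "?S = {}" using block_sizes_ordered_blocks by auto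
    then show ?thesis using False by (simp only: sum.empty if_False)
  qed
  finally show "chi (nc_M P) m = (qsym_M (block_sizes P) m :: 'a)"
    unfolding qsym_M_apply[OF is_composition_block_sizes[OF P]] .
qed

lemma finite_set_compositions: "finite {P. is_set_composition n P \<and> block_sizes P = \<beta>}"
proof (rule finite_subset)
  show "{P. is_set_composition n P \<and> block_sizes P = \<beta>} \<subseteq>
      {P. set P \<subseteq> Pow {1..n} \<and> length P = length \<beta>}"
    by (auto simp: is_set_composition_def block_sizes_def)
  show "finite {P. set P \<subseteq> Pow {1..n} \<and> length P = length \<beta>}"
    by (rule finite_lists_length_eq) simp
qed

lemma sum_nc_M_apply:
  "(\<Sum>P | is_set_composition n P \<and> block_sizes P = \<beta>. nc_M P w) =
    (if length w = n \<and> 0 \<notin> set w \<and> mset_composition (mset w) = \<beta> then 1 else (0::'a::field))"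
proof -
  have "(\<Sum>P | is_set_composition n P \<and> block_sizes P = \<beta>. nc_M P w) =
    (\<Sum>P | is_set_composition n P \<and> block_sizes P = \<beta>.
      if P = ordered_blocks w then if length w = n \<and> 0 \<notin> set w then 1 else 0 else (0::'a))"
    by (intro sum.cong) (auto simp: nc_M_apply)
  then show ?thesis
    using is_set_composition_ordered_blocks[of w] block_sizes_ordered_blocks[of w]
    by (auto simp: sum.delta finite_set_compositions)
qed

lemma comp_fact_mset_composition:
  "comp_fact (mset_composition m) = (\<Prod>v\<in>set_mset m. fact (count m v))"
  unfolding comp_fact_def mset_composition_def
  using prod.distinct_set_conv_list[OF distinct_mset_support, of "\<lambda>v. fact (count m v) :: nat" m]
  by (simp add: comp_def)

text \<open>
  The multinomial coefficient \<open>n!/\<beta>!\<close>, stated without division.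
\<close>

lemma card_words_of_mset:
  "card {w. mset w = m} * comp_fact (mset_composition m) = fact (size m)"
proof -
  have "card {w. mset w = m} = fact (size m) div (\<Prod>v\<in>set_mset m. fact (count m v))"
    "(\<Prod>v\<in>set_mset m. fact (count m v)) dvd (fact (size m) :: nat)"
    using card_permutations_of_multiset[of m] by (auto simp: permutations_of_multiset_def)
  then show ?thesis by (simp add: comp_fact_mset_composition)
qed

text \<open>
  Set compositions with block sizes \<open>\<beta>\<close> correspond to the rearrangements of the
  word \<open>1\<cdots>12\<cdots>2\<cdots>\<close> with multiplicities \<open>\<beta>\<close>.
\<close>

lemma card_set_compositions:
  assumes "is_composition \<beta>"
  shows "card {P. is_set_composition (sum_list \<beta>) P \<and> block_sizes P = \<beta>} * comp_fact \<beta> =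
    fact (sum_list \<beta>)"
proof -
  let ?m = "standard_mset \<beta>" and ?n = "sum_list \<beta>"
  have m: "mset_composition ?m = \<beta>" "size ?m = ?n"
    using standard_mset_properties[OF assms] by (auto simp: standard_mset_def size_weighted_mset)
  have len: "length w = ?n" if "mset w = ?m" for w using that m(2) by (metis size_mset)
  have "bij_betw ordered_blocks {w. mset w = ?m}
      {P. is_set_composition ?n P \<and> block_sizes P = \<beta>}"
    unfolding bij_betw_def
  proof (intro conjI inj_onI set_eqI iffI)
    fix w w' assume a: "w \<in> {w. mset w = ?m}" "w' \<in> {w. mset w = ?m}"
      "ordered_blocks w = ordered_blocks w'"
    have "is_set_composition ?n (ordered_blocks w)" "mset_composition ?m = block_sizes (ordered_blocks w)"
      using a is_set_composition_ordered_blocks[of w] len[of w]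
      by (auto simp: block_sizes_ordered_blocks)
    from ex1_word_with_blocks[OF this] show "w = w'" using a len by auto
  next
    fix P assume "P \<in> ordered_blocks ` {w. mset w = ?m}"
    then show "P \<in> {P. is_set_composition ?n P \<and> block_sizes P = \<beta>}"
      using is_set_composition_ordered_blocks len m by (auto simp: block_sizes_ordered_blocks) metis
  next
    fix P assume "P \<in> {P. is_set_composition ?n P \<and> block_sizes P = \<beta>}"
    then show "P \<in> ordered_blocks ` {w. mset w = ?m}"
      using ex1_word_with_blocks[of ?n P ?m] m by blast
  qed
  then have "card {w. mset w = ?m} = card {P. is_set_composition ?n P \<and> block_sizes P = \<beta>}"
    by (rule bij_betw_same_card)
  then show ?thesis using card_words_of_mset[of ?m] m by simp
qed

section \<open>Counting the dottings of a tableau\<close>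

lemma prod_fact_count_add_mset:
  "(\<Prod>u\<in>set_mset (add_mset v M). fact (count (add_mset v M) u)) =
    (Suc (count M v) * (\<Prod>u\<in>set_mset M. fact (count M u)) :: nat)"
proof -
  let ?R = "\<Prod>u\<in>set_mset M - {v}. fact (count M u) :: nat"
  have "(\<Prod>u\<in>set_mset (add_mset v M). fact (count (add_mset v M) u)) =
      fact (Suc (count M v)) * (\<Prod>u\<in>set_mset M - {v}. fact (count (add_mset v M) u) :: nat)"
    by (simp add: prod.insert_remove)
  also have "(\<Prod>u\<in>set_mset M - {v}. fact (count (add_mset v M) u) :: nat) = ?R"
    by (intro prod.cong) auto
  finally have 1: "(\<Prod>u\<in>set_mset (add_mset v M). fact (count (add_mset v M) u)) =
      fact (Suc (count M v)) * ?R" .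
  have 2: "(\<Prod>u\<in>set_mset M. fact (count M u)) = fact (count M v) * ?R"
  proof (cases "v \<in># M")
    case True
    then show ?thesis by (simp add: prod.remove)
  next
    case False
    then show ?thesis by (simp add: not_in_iff)
  qed
  show ?thesis unfolding 1 2 by (simp add: algebra_simps)
qed

text \<open>
  Such a bijection consists of one bijection between the fibres of \<open>h\<close> and
  \<open>g\<close> over each value \<open>v\<close>. The induction over \<open>A\<close> first
  chooses the image of one element: it can be any point of the corresponding fibre of
  \<open>g\<close>, and the rest is a bijection of the same kind between the remaining points.
\<close>

lemma card_bij_with_prescribed_values:
  assumes "finite A" "finite B" "image_mset h (mset_set A) = image_mset g (mset_set B)"
  shows "card {f \<in> extensional A. bij_betw f A B \<and> (\<forall>a\<in>A. g (f a) = h a)} =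
    (\<Prod>v\<in>set_mset (image_mset h (mset_set A)). fact (count (image_mset h (mset_set A)) v))"
  using assms
proof (induction A arbitrary: B rule: finite_induct)
  case empty
  then have "B = {}" by (simp add: mset_set_empty_iff)
  then have "{f \<in> extensional {}. bij_betw f {} B \<and> (\<forall>a\<in>{}. g (f a) = h a)} = {\<lambda>_. undefined}"
    by (auto simp: bij_betw_def)
  then show ?case by simp
next
  case (insert a A)
  let ?F = "\<lambda>A B. {f \<in> extensional A. bij_betw f A B \<and> (\<forall>a\<in>A. g (f a) = h a)}"
  let ?M = "image_mset h (mset_set A)"
  let ?\<Pi> = "\<lambda>M. \<Prod>v\<in>set_mset M. fact (count M v) :: nat"
  define C where "C = {b \<in> B. g b = h a}"
  have M: "image_mset h (mset_set (insert a A)) = add_mset (h a) ?M" using insert by simp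
  have cardC: "card C = Suc (count ?M (h a))"
  proof -
    have "card C = count (image_mset g (mset_set B)) (h a)"
      unfolding C_def using insert.prems by (simp add: count_image_mset_eq_card_vimage)
    also have "\<dots> = count (add_mset (h a) ?M) (h a)" using insert.prems M by simp
    finally show ?thesis by simp
  qed
  have IH: "card (?F A (B - {b})) = ?\<Pi> ?M" if "b \<in> C" for b
  proof (rule insert.IH)
    show "finite (B - {b})" using insert by simp
    have "mset_set B = add_mset b (mset_set (B - {b}))"
      using that insert.prems(1) by (simp add: C_def mset_set.remove)
    then show "?M = image_mset g (mset_set (B - {b}))"
      using insert.prems M that by (auto simp: C_def)
  qed
  have "bij_betw (\<lambda>f. (f a, restrict f A)) (?F (insert a A) B) (SIGMA b:C. ?F A (B - {b}))"
  proof (rule bij_betw_byWitness[where f' = "\<lambda>(b, f). f(a := b)"])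
    show "\<forall>f\<in>?F (insert a A) B. (case (f a, restrict f A) of (b, f) \<Rightarrow> f(a := b)) = f"
      by (auto simp: fun_eq_iff extensional_def)
    show "\<forall>x\<in>SIGMA b:C. ?F A (B - {b}). (\<lambda>f. (f a, restrict f A)) (case x of (b, f) \<Rightarrow> f(a := b)) = x"
      using insert.hyps(2) by (auto simp: fun_eq_iff extensional_def)
    show "(\<lambda>f. (f a, restrict f A)) ` ?F (insert a A) B \<subseteq> (SIGMA b:C. ?F A (B - {b}))"
    proof (clarsimp, intro conjI)
      fix f assume f: "bij_betw f (insert a A) B" "g (f a) = h a" "\<forall>x\<in>A. g (f x) = h x"
      show "f a \<in> C" using f by (auto simp: C_def bij_betw_def)
      show "bij_betw f A (B - {f a})"
        using f(1) insert.hyps(2) by (auto simp: bij_betw_def inj_on_def)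
    qed
    show "(\<lambda>(b, f). f(a := b)) ` (SIGMA b:C. ?F A (B - {b})) \<subseteq> ?F (insert a A) B"
    proof
      fix y assume "y \<in> (\<lambda>(b, f). f(a := b)) ` (SIGMA b:C. ?F A (B - {b}))"
      then obtain b f where y: "y = f(a := b)" and b: "b \<in> C"
        and f: "f \<in> extensional A" "bij_betw f A (B - {b})" "\<forall>a\<in>A. g (f a) = h a"
        by auto
      have "bij_betw (f(a := b)) A (B - {b})"
        using f(2) insert.hyps(2) by (subst bij_betw_cong[of A "f(a := b)" f]) auto
      then have "bij_betw (f(a := b)) (insert a A) (insert b (B - {b}))"
        using insert.hyps(2) by (auto simp: bij_betw_def)
      moreover have "insert b (B - {b}) = B" using b by (auto simp: C_def)
      ultimately show "y \<in> ?F (insert a A) B"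
        using b f insert.hyps(2) unfolding y by (auto simp: C_def extensional_def)
    qed
  qed
  then have "card (?F (insert a A) B) = card (SIGMA b:C. ?F A (B - {b}))"
    by (rule bij_betw_same_card)
  also have "\<dots> = (\<Sum>b\<in>C. card (?F A (B - {b})))"
  proof (rule card_SigmaI)
    show "finite C" using insert.prems(1) by (simp add: C_def)
    show "\<forall>b\<in>C. finite (?F A (B - {b}))"
    proof
      fix b assume b: "b \<in> C"
      \<comment> \<open>The formula for the cardinality shows in passing that the set is finite.\<close>
      have "0 < card (?F A (B - {b}))" unfolding IH[OF b] by (intro prod_pos) simp
      then show "finite (?F A (B - {b}))" by (rule card_ge_0_finite)
    qed
  qed
  also have "\<dots> = card C * ?\<Pi> ?M" using IH by simp
  also have "\<dots> = ?\<Pi> (add_mset (h a) ?M)"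
    unfolding cardC prod_fact_count_add_mset ..
  finally show ?case unfolding M .
qed

lemma finite_diagram [simp]: "finite (diagram \<alpha>)"
proof -
  have "diagram \<alpha> = (SIGMA i:{..<length \<alpha>}. {..<\<alpha> ! i})" by (auto simp: diagram_def)
  then show ?thesis by simp
qed

lemma card_diagram: "card (diagram \<alpha>) = sum_list \<alpha>"
proof -
  have "diagram \<alpha> = (SIGMA i:{..<length \<alpha>}. {..<\<alpha> ! i})" by (auto simp: diagram_def)
  then show ?thesis by (simp add: sum_list_sum_nth atLeast0LessThan)
qed

lemma size_content: "size (content \<alpha> T) = sum_list \<alpha>"
  by (simp add: content_def card_diagram)

lemma set_content: "set_mset (content \<alpha> T) = T ` diagram \<alpha>"
  by (simp add: content_def)

lemma mset_eq_image_positions: "mset w = image_mset (\<lambda>j. w ! (j - 1)) (mset_set {1..length w})"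
  by (rule multiset_eqI) (simp only: count_image_mset_eq_card_vimage finite_atLeastAtMost card_positions)

lemma dotted_word_eq_iff:
  assumes d: "bij_betw d (diagram \<alpha>) {1..card (diagram \<alpha>)}"
  shows "dotted_word \<alpha> (T, d) = w \<longleftrightarrow>
    length w = card (diagram \<alpha>) \<and> (\<forall>c\<in>diagram \<alpha>. w ! (d c - 1) = T c)"
proof -
  let ?D = "diagram \<alpha>" and ?w = "dotted_word \<alpha> (T, d)"
  have len: "length ?w = card ?D" by (simp add: dotted_word_def del: upt_Suc)
  have inj: "inj_on d ?D" and im: "d ` ?D = {1..card ?D}" using d by (auto simp: bij_betw_def)
  have nth: "?w ! (d c - 1) = T c" if "c \<in> ?D" for c
  proof -
    have "d c \<in> {1..card ?D}" using im that by blast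
    then show ?thesis using the_inv_into_f_f[OF inj that]
      by (auto simp: dotted_word_def simp del: upt_Suc)
  qed
  show ?thesis
  proof (intro iffI)
    assume R: "length w = card ?D \<and> (\<forall>c\<in>?D. w ! (d c - 1) = T c)"
    show "?w = w"
    proof (rule nth_equalityI)
      show "length ?w = length w" using R len by simp
      fix i assume "i < length ?w"
      then have "Suc i \<in> d ` ?D" using im len by simp
      then obtain c where "c \<in> ?D" "Suc i = d c" by blast
      then show "?w ! i = w ! i" using nth[of c] R by (metis diff_Suc_1)
    qed
  qed (use len nth in auto)
qed

text \<open>
  Dots are a bijection from cells to positions under which the entry of a cell is the letter at
  its position. It exists only if the content is \<open>mset w\<close>, and then the number of
  choices depends on \<open>w\<close> alone.
\<close>

lemma gen_series_dotted:
  assumes fin: "finite {T \<in> \<T>. content \<alpha> T = mset w}"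
  shows "(gen_series (dotted \<alpha> \<T>) (dotted_word \<alpha>) w :: 'a::field) =
    of_nat (comp_fact (mset_composition (mset w)) * card {T \<in> \<T>. content \<alpha> T = mset w})"
proof -
  let ?D = "diagram \<alpha>" and ?n = "length w"
  let ?F = "\<lambda>T. {d \<in> extensional ?D. bij_betw d ?D {1..?n} \<and> (\<forall>c\<in>?D. w ! (d c - 1) = T c)}"
  let ?\<U> = "{T \<in> \<T>. content \<alpha> T = mset w}"
  have eq: "{a \<in> dotted \<alpha> \<T>. dotted_word \<alpha> a = w} = (SIGMA T:?\<U>. ?F T)"
  proof (intro set_eqI)
    fix a :: "(nat \<times> nat \<Rightarrow> nat) \<times> (nat \<times> nat \<Rightarrow> nat)"
    obtain T d where a: "a = (T, d)" by (cases a)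
    have c: "content \<alpha> T = mset w" if "d \<in> ?F T"
    proof -
      have "mset_set {1..?n} = image_mset d (mset_set ?D)"
        using that image_mset_mset_set[of d ?D] by (simp add: bij_betw_def)
      then have "mset w = image_mset (\<lambda>c. w ! (d c - 1)) (mset_set ?D)"
        using mset_eq_image_positions[of w] by (simp add: comp_def image_mset.compositionality)
      also have "\<dots> = content \<alpha> T"
        unfolding content_def by (intro image_mset_cong) (use that in auto)
      finally show ?thesis by simp
    qed
    have n: "?n = card ?D" if "content \<alpha> T = mset w"
      using arg_cong[OF that, of size] by (simp add: content_def)
    show "a \<in> {a \<in> dotted \<alpha> \<T>. dotted_word \<alpha> a = w} \<longleftrightarrow> a \<in> (SIGMA T:?\<U>. ?F T)"
    proof
      assume "a \<in> {a \<in> dotted \<alpha> \<T>. dotted_word \<alpha> a = w}"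
      then have L: "T \<in> \<T>" "d \<in> extensional ?D" "bij_betw d ?D {1..card ?D}"
        "dotted_word \<alpha> (T, d) = w" by (auto simp: a dotted_def)
      then have "d \<in> ?F T" using dotted_word_eq_iff[OF L(3), of T w] by simp
      then show "a \<in> (SIGMA T:?\<U>. ?F T)" using c L(1) unfolding a by blast
    next
      assume "a \<in> (SIGMA T:?\<U>. ?F T)"
      then have R: "T \<in> ?\<U>" "d \<in> ?F T" unfolding a by blast+
      then have "bij_betw d ?D {1..card ?D}" using n by simp
      then show "a \<in> {a \<in> dotted \<alpha> \<T>. dotted_word \<alpha> a = w}"
        using R n dotted_word_eq_iff[of d \<alpha> T w] by (simp add: a dotted_def)
    qed
  qed
  have F: "card (?F T) = comp_fact (mset_composition (mset w))" if "T \<in> ?\<U>" for T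
  proof -
    have "image_mset T (mset_set ?D) = mset w" using that by (simp add: content_def)
    then show ?thesis
      using card_bij_with_prescribed_values[of ?D "{1..?n}" T "\<lambda>j. w ! (j - 1)"]
        mset_eq_image_positions[of w]
      by (simp add: comp_fact_mset_composition)
  qed
  have "card (SIGMA T:?\<U>. ?F T) = (\<Sum>T\<in>?\<U>. card (?F T))"
  proof (rule card_SigmaI[OF fin], intro ballI)
    fix T assume T: "T \<in> ?\<U>"
    have "0 < card (?F T)"
      unfolding F[OF T] comp_fact_mset_composition by (intro prod_pos) simp
    then show "finite (?F T)" by (rule card_ge_0_finite)
  qed
  also have "\<dots> = comp_fact (mset_composition (mset w)) * card ?\<U>" using F by simp
  finally show ?thesis unfolding gen_series_def eq by simp
qed

section \<open>Composition tableaux of given content\<close>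

lemma finite_fillings_of_content:
  assumes "\<T> \<subseteq> extensional (diagram \<alpha>)"
  shows "finite {T \<in> \<T>. content \<alpha> T = m}"
proof (rule finite_subset)
  show "{T \<in> \<T>. content \<alpha> T = m} \<subseteq> (\<Pi>\<^sub>E c\<in>diagram \<alpha>. set_mset m)"
    using assms set_content by (auto simp: PiE_def)
qed (simp add: finite_PiE)

lemma SSCT_extensional: "SSCT \<alpha> \<subseteq> extensional (diagram \<alpha>)"
  by (auto simp: SSCT_def PiE_def)

lemma SSRT_extensional: "SSRT l \<subseteq> extensional (diagram l)"
  by (auto simp: SSRT_def PiE_def)

lemma content_pos:
  assumes "T \<in> SSCT \<alpha> \<union> SSRT \<alpha>"
  shows "0 \<notin># content \<alpha> T"
proof -
  have "T \<in> diagram \<alpha> \<rightarrow>\<^sub>E {1..}" using assms by (auto simp only: SSCT_def SSRT_def)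
  then have "T ` diagram \<alpha> \<subseteq> {1..}" by auto
  then show ?thesis unfolding set_content by (metis atLeast_iff not_one_le_zero subsetD)
qed

text \<open>
  The conditions on an SSCT only compare entries, so composing with a strictly increasing map of
  the values yields an SSCT again. Applied to the inverse map this gives the opposite inequality.
\<close>

lemma card_SSCT_relabel_le:
  assumes mono: "strict_mono_on (set_mset m) \<phi>" and pos: "\<forall>v\<in>#m. 0 < \<phi> v"
  shows "card {T \<in> SSCT \<alpha>. content \<alpha> T = m} \<le>
    card {T \<in> SSCT \<alpha>. content \<alpha> T = image_mset \<phi> m}"
proof (rule card_inj_on_le[where f = "\<lambda>T. restrict (\<phi> \<circ> T) (diagram \<alpha>)"])
  let ?D = "diagram \<alpha>"
  show "finite {T \<in> SSCT \<alpha>. content \<alpha> T = image_mset \<phi> m}"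
    by (rule finite_fillings_of_content[OF SSCT_extensional])
  show "inj_on (\<lambda>T. restrict (\<phi> \<circ> T) ?D) {T \<in> SSCT \<alpha>. content \<alpha> T = m}"
  proof (rule inj_onI)
    fix S T assume S: "S \<in> {T \<in> SSCT \<alpha>. content \<alpha> T = m}"
      and T: "T \<in> {T \<in> SSCT \<alpha>. content \<alpha> T = m}"
      and eq: "restrict (\<phi> \<circ> S) ?D = restrict (\<phi> \<circ> T) ?D"
    have mem: "S c \<in># m" "T c \<in># m" if "c \<in> ?D" for c
      using S T that set_content[of \<alpha> S] set_content[of \<alpha> T] by auto
    have "\<phi> (S c) = \<phi> (T c)" if "c \<in> ?D" for c
      using fun_cong[OF eq, of c] that by simp
    then have "S c = T c" if "c \<in> ?D" for c
      using mem that strict_mono_on_eqD[OF mono] by metis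
    moreover have "S \<in> extensional ?D" "T \<in> extensional ?D"
      using S T SSCT_extensional[of \<alpha>] by blast+
    ultimately show "S = T" by (intro extensionalityI[of S ?D T])
  qed
  show "(\<lambda>T. restrict (\<phi> \<circ> T) ?D) ` {T \<in> SSCT \<alpha>. content \<alpha> T = m} \<subseteq>
      {T \<in> SSCT \<alpha>. content \<alpha> T = image_mset \<phi> m}"
  proof clarify
    fix T assume T: "T \<in> SSCT \<alpha>" and m: "m = content \<alpha> T"
    have mem: "T c \<in># m" if "c \<in> ?D" for c
      using that m set_content[of \<alpha> T] by auto
    have le: "\<phi> (T c) \<le> \<phi> (T d) \<longleftrightarrow> T c \<le> T d" if "c \<in> ?D" "d \<in> ?D" for c d
      using strict_mono_on_less_eq[OF mono] mem that by metis
    have lt: "\<phi> (T c) < \<phi> (T d) \<longleftrightarrow> T c < T d" if "c \<in> ?D" "d \<in> ?D" for c d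
      using strict_mono_on_less[OF mono] mem that by metis
    have "restrict (\<phi> \<circ> T) ?D \<in> ?D \<rightarrow>\<^sub>E {1..}"
      using pos mem by (auto simp: Suc_le_eq)
    moreover have "content \<alpha> (restrict (\<phi> \<circ> T) ?D) = image_mset \<phi> (content \<alpha> T)"
      unfolding content_def image_mset.compositionality by (intro image_mset_cong) auto
    ultimately show "restrict (\<phi> \<circ> T) ?D \<in> SSCT \<alpha> \<and>
        content \<alpha> (restrict (\<phi> \<circ> T) ?D) = image_mset \<phi> (content \<alpha> T)"
      using T unfolding SSCT_def rows_weakly_decreasing_def by (auto simp: le lt)
  qed
qed

lemma image_weighted_mset:
  assumes "length xs = length \<beta>"
  shows "image_mset f (weighted_mset \<beta> xs) = weighted_mset \<beta> (map f xs)"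
proof -
  have "image_mset f (weighted_mset \<beta> xs) =
      (\<Sum>j<length \<beta>. image_mset f (replicate_mset (\<beta> ! j) (xs ! j)))"
    unfolding weighted_mset_def
    using sum_comp_morphism[of "image_mset f" "\<lambda>j. replicate_mset (\<beta> ! j) (xs ! j)"]
    by (simp add: comp_def)
  then show ?thesis using assms by (simp add: weighted_mset_def)
qed

lemma count_standard_mset:
  assumes "is_composition \<beta>"
  shows "count (standard_mset \<beta>) (Suc i) = (if i < length \<beta> then \<beta> ! i else 0)"
proof (cases "i < length \<beta>")
  case True
  then show ?thesis
    using count_weighted_mset_nth[of "[1..<Suc (length \<beta>)]" \<beta> i]
    by (simp add: standard_mset_def del: upt_Suc)
next
  case False
  then have "Suc i \<notin># standard_mset \<beta>" using standard_mset_properties(3)[OF assms] by simp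
  then show ?thesis using False by (simp add: not_in_iff)
qed

lemma K_number_eq_card_standard:
  assumes "is_composition \<beta>"
  shows "K_number \<alpha> \<beta> = card {T \<in> SSCT \<alpha>. content \<alpha> T = standard_mset \<beta>}"
proof -
  have "(\<forall>i. count (content \<alpha> T) (i + 1) = (if i < length \<beta> then \<beta> ! i else 0)) \<longleftrightarrow>
      content \<alpha> T = standard_mset \<beta>" if "T \<in> SSCT \<alpha>" for T
  proof -
    have "count (content \<alpha> T) 0 = count (standard_mset \<beta>) 0"
      using content_pos[of T \<alpha>] that standard_mset_properties(1)[OF assms] by (simp add: not_in_iff)
    then have "content \<alpha> T = standard_mset \<beta> \<longleftrightarrow>
        (\<forall>i. count (content \<alpha> T) (Suc i) = count (standard_mset \<beta>) (Suc i))"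
      unfolding multiset_eq_iff by (metis not0_implies_Suc)
    then show ?thesis by (simp add: count_standard_mset[OF assms])
  qed
  then show ?thesis unfolding K_number_def by (intro arg_cong[of _ _ card] Collect_cong) blast
qed

text \<open>
  Quasisymmetry of \<open>\<S>\<^sub>\<alpha>\<close>: replacing the \<open>i\<close>-th smallest
  value by \<open>i\<close> turns the content into the standard one.
\<close>

lemma card_SSCT_content:
  assumes pos: "0 \<notin># m"
  shows "card {T \<in> SSCT \<alpha>. content \<alpha> T = m} = K_number \<alpha> (mset_composition m)"
proof -
  let ?\<beta> = "mset_composition m" and ?vs = "mset_support m"
  define L where "L = length ?vs"
  define \<phi> where "\<phi> i = ?vs ! (i - 1)" for i
  let ?\<psi> = "inv_into {1..L} \<phi>"
  have comp: "is_composition ?\<beta>" by (rule is_composition_mset_composition)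
  have set: "set_mset (standard_mset ?\<beta>) = {1..L}" using standard_mset_properties(3)[OF comp] by (simp add: L_def)
  have mono: "strict_mono_on {1..L} \<phi>"
    unfolding strict_mono_on_def \<phi>_def
    using sorted_mset_support[of m] by (auto simp: sorted_wrt_iff_nth_less L_def)
  have "map \<phi> [1..<Suc L] = ?vs"
    by (rule nth_equalityI) (auto simp: L_def \<phi>_def simp del: upt_Suc)
  then have m: "image_mset \<phi> (standard_mset ?\<beta>) = m"
    by (simp add: standard_mset_def image_weighted_mset L_def weighted_mset_composition del: upt_Suc)
  then have im: "set_mset m = \<phi> ` {1..L}" using set by (metis set_image_mset)
  have inj: "inj_on \<phi> {1..L}" using mono by (rule strict_mono_on_imp_inj_on)
  have inv: "?\<psi> (\<phi> i) = i" if "i \<in> {1..L}" for i using inj that by (rule inv_into_f_f)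
  have "image_mset ?\<psi> m = image_mset (?\<psi> \<circ> \<phi>) (standard_mset ?\<beta>)"
    by (metis m multiset.map_comp)
  also have "\<dots> = image_mset id (standard_mset ?\<beta>)"
    by (intro image_mset_cong) (use set inv in auto)
  finally have inverse: "image_mset ?\<psi> m = standard_mset ?\<beta>" by simp
  have "card {T \<in> SSCT \<alpha>. content \<alpha> T = standard_mset ?\<beta>} \<le> card {T \<in> SSCT \<alpha>. content \<alpha> T = m}"
    using card_SSCT_relabel_le[of "standard_mset ?\<beta>" \<phi> \<alpha>] mono set m im pos
    by (metis gr0I image_eqI)
  moreover have "strict_mono_on (set_mset m) ?\<psi>"
    unfolding strict_mono_on_def im using inv strict_mono_on_less[OF mono] by auto
  then have "card {T \<in> SSCT \<alpha>. content \<alpha> T = m} \<le> card {T \<in> SSCT \<alpha>. content \<alpha> T = standard_mset ?\<beta>}"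
    using card_SSCT_relabel_le[of m ?\<psi> \<alpha>] inverse inv im by auto
  ultimately show ?thesis by (simp add: K_number_eq_card_standard[OF comp])
qed

lemma no_tableau_with_zero:
  assumes "0 \<in># m"
  shows "{T \<in> SSCT \<alpha>. content \<alpha> T = m} = {}" "{T \<in> SSRT \<alpha>. content \<alpha> T = m} = {}"
  using content_pos[of _ \<alpha>] assms by auto

lemma K_number_eq_0:
  assumes "is_composition \<beta>" "sum_list \<beta> \<noteq> sum_list \<alpha>"
  shows "K_number \<alpha> \<beta> = 0"
proof -
  have "{T \<in> SSCT \<alpha>. content \<alpha> T = standard_mset \<beta>} = {}"
    using assms(2) unfolding standard_mset_def
    by (metis (mono_tags, lifting) empty_Collect_eq size_content size_weighted_mset)
  then show ?thesis unfolding K_number_eq_card_standard[OF assms(1)] by (simp only: card.empty)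
qed

section \<open>Expansions into monomial functions\<close>

lemma nc_qschur_apply:
  "(nc_qschur \<alpha> w :: 'a::field) =
    (if 0 \<in> set w then 0
     else of_nat (comp_fact (mset_composition (mset w)) * K_number \<alpha> (mset_composition (mset w))))"
  unfolding nc_qschur_def gen_series_dotted[OF finite_fillings_of_content[OF SSCT_extensional]]
  by (cases "0 \<in> set w") (simp_all add: no_tableau_with_zero card_SSCT_content del: Collect_empty_eq)

lemma nc_schur_apply:
  "(nc_schur l w :: 'a::field) =
    of_nat (comp_fact (mset_composition (mset w)) * card {T \<in> SSRT l. content l T = mset w})"
  unfolding nc_schur_def gen_series_dotted[OF finite_fillings_of_content[OF SSRT_extensional]] ..

lemma qschur_apply:
  "(qschur \<alpha> m :: 'a::field) = (if 0 \<in># m then 0 else of_nat (K_number \<alpha> (mset_composition m)))"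
  unfolding qschur_def gen_series_def
  by (cases "0 \<in># m") (simp_all add: no_tableau_with_zero card_SSCT_content del: Collect_empty_eq)

lemma finite_compositions: "finite {\<beta>. is_composition \<beta> \<and> sum_list \<beta> = n}"
proof (rule finite_subset)
  show "{\<beta>. is_composition \<beta> \<and> sum_list \<beta> = n} \<subseteq> {\<beta>. set \<beta> \<subseteq> {..n} \<and> length \<beta> \<le> n}"
  proof clarsimp
    fix \<beta> assume c: "is_composition \<beta>" and n: "n = sum_list \<beta>"
    have "length \<beta> \<le> sum_list \<beta>"
      using c unfolding is_composition_def by (induction \<beta>) auto
    then show "set \<beta> \<subseteq> {..sum_list \<beta>} \<and> length \<beta> \<le> sum_list \<beta>"
      using member_le_sum_list by auto
  qed
qed (simp add: finite_lists_length_le)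

lemma nc_qschur_expansion:
  assumes "sum_list \<alpha> = n"
  shows "(nc_qschur \<alpha> :: nat list \<Rightarrow> 'a::field) =
    (\<Sum>\<beta> | is_composition \<beta> \<and> sum_list \<beta> = n.
       series_scale (of_nat (comp_fact \<beta> * K_number \<alpha> \<beta>))
         (\<Sum>P | is_set_composition n P \<and> block_sizes P = \<beta>. nc_M P))"
proof
  fix w :: "nat list"
  let ?\<gamma> = "mset_composition (mset w)"
  let ?S = "{\<beta>. is_composition \<beta> \<and> sum_list \<beta> = n}"
  have g: "is_composition ?\<gamma>" "sum_list ?\<gamma> = length w"
    by (auto simp: is_composition_mset_composition sum_list_mset_composition)
  have "(\<Sum>\<beta>\<in>?S. series_scale (of_nat (comp_fact \<beta> * K_number \<alpha> \<beta>))
         (\<Sum>P | is_set_composition n P \<and> block_sizes P = \<beta>. nc_M P)) w =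
      (\<Sum>\<beta>\<in>?S. if \<beta> = ?\<gamma> then if length w = n \<and> 0 \<notin> set w
         then of_nat (comp_fact \<beta> * K_number \<alpha> \<beta>) else 0 else (0::'a))"
    unfolding sum_fun_apply series_scale_def sum_nc_M_apply by (intro sum.cong) auto
  also have "\<dots> = nc_qschur \<alpha> w"
    using g K_number_eq_0[OF g(1), of \<alpha>] assms
    by (auto simp: finite_compositions nc_qschur_apply)
  finally show "nc_qschur \<alpha> w = (\<Sum>\<beta>\<in>?S. series_scale (of_nat (comp_fact \<beta> * K_number \<alpha> \<beta>))
         (\<Sum>P | is_set_composition n P \<and> block_sizes P = \<beta>. nc_M P :: nat list \<Rightarrow> 'a)) w" by simp
qed

lemma qschur_expansion:
  assumes "sum_list \<alpha> = n"
  shows "(qschur \<alpha> :: nat multiset \<Rightarrow> 'a::field) =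
    (\<Sum>\<beta> | is_composition \<beta> \<and> sum_list \<beta> = n. series_scale (of_nat (K_number \<alpha> \<beta>)) (qsym_M \<beta>))"
proof
  fix m :: "nat multiset"
  let ?\<gamma> = "mset_composition m"
  let ?S = "{\<beta>. is_composition \<beta> \<and> sum_list \<beta> = n}"
  have g: "is_composition ?\<gamma>" by (rule is_composition_mset_composition)
  have "(\<Sum>\<beta>\<in>?S. series_scale (of_nat (K_number \<alpha> \<beta>)) (qsym_M \<beta>)) m =
      (\<Sum>\<beta>\<in>?S. if \<beta> = ?\<gamma> then if 0 \<notin># m then of_nat (K_number \<alpha> \<beta>) else 0 else (0::'a))"
    unfolding sum_fun_apply series_scale_def by (intro sum.cong) (auto simp: qsym_M_apply)
  also have "\<dots> = qschur \<alpha> m"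
    using g K_number_eq_0[OF g(1), of \<alpha>] assms
    by (auto simp: finite_compositions qschur_apply)
  finally show "qschur \<alpha> m = (\<Sum>\<beta>\<in>?S. series_scale (of_nat (K_number \<alpha> \<beta>))
      (qsym_M \<beta> :: nat multiset \<Rightarrow> 'a)) m" by simp
qed

text \<open>
  The \<open>n!/\<beta>!\<close> words with a given commutative image in \<open>x\<^sub>1,
  x\<^sub>2, \<dots>\<close> all have the coefficient \<open>\<beta>!
  K\<^sub>\<alpha>\<^sub>\<beta>\<close>.
\<close>

lemma chi_nc_qschur:
  assumes "sum_list \<alpha> = n"
  shows "chi (nc_qschur \<alpha>) = (series_scale (fact n) (qschur \<alpha>) :: _ \<Rightarrow> 'a::field_char_0)"
proof
  fix m
  let ?\<gamma> = "mset_composition m"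
  have "(chi (nc_qschur \<alpha>) m :: 'a) = (\<Sum>w | mset w = m. if 0 \<in># m then 0
     else of_nat (comp_fact ?\<gamma> * K_number \<alpha> ?\<gamma>))"
    unfolding chi_def by (intro sum.cong) (auto simp: nc_qschur_apply)
  also have "\<dots> = (if 0 \<in># m then 0
      else of_nat (card {w. mset w = m} * comp_fact ?\<gamma> * K_number \<alpha> ?\<gamma>))"
    by simp
  also have "\<dots> = series_scale (fact n) (qschur \<alpha>) m"
    unfolding card_words_of_mset series_scale_def qschur_apply
    using K_number_eq_0[OF is_composition_mset_composition, of m \<alpha>] assms
    by (cases "size m = n") (auto simp: sum_list_mset_composition)
  finally show "chi (nc_qschur \<alpha>) m = (series_scale (fact n) (qschur \<alpha>) m :: 'a)" .
qed

section \<open>Columns and their sets of entries\<close>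

text \<open>
  A column is a function from row indices to entries in which the value \<open>0\<close> marks a
  missing cell. With this convention the conditions on a tableau become inequalities between
  adjacent columns that do not mention the shape.
\<close>

definition entries :: "(nat \<Rightarrow> nat) \<Rightarrow> nat set" where
  "entries c = range c - {0}"

definition column_inj :: "(nat \<Rightarrow> nat) \<Rightarrow> bool" where
  "column_inj c \<longleftrightarrow> finite {i. 0 < c i} \<and> inj_on c {i. 0 < c i}"

text \<open>
  For finite sets of positive integers, sorted decreasingly: \<open>E\<close> has at least as many
  elements as \<open>F\<close>, and the \<open>i\<close>-th element of \<open>E\<close> is at
  least the \<open>i\<close>-th element of \<open>F\<close>.
\<close>

definition dominates :: "nat set \<Rightarrow> nat set \<Rightarrow> bool" where
  "dominates E F \<longleftrightarrow> (\<forall>e>0. card {x \<in> F. e \<le> x} \<le> card {x \<in> E. e \<le> x})"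

text \<open>
  The row and triple conditions of an SSCT for two adjacent columns \<open>c\<close> and
  \<open>d\<close>. In the triple condition the conclusion \<open>d j < d i\<close> with \<open>d
  j > 0\<close> already implies that row \<open>i\<close> has a cell in the column
  \<open>d\<close>.
\<close>

definition next_column :: "(nat \<Rightarrow> nat) \<Rightarrow> (nat \<Rightarrow> nat) \<Rightarrow> bool" where
  "next_column c d \<longleftrightarrow> (\<forall>i. d i \<le> c i) \<and> (\<forall>i j. i < j \<longrightarrow> 0 < d j \<longrightarrow> d j \<le> c i \<longrightarrow> d j < d i)"

lemma entries_iff: "x \<in> entries c \<longleftrightarrow> 0 < x \<and> (\<exists>i. c i = x)"
  by (auto simp: entries_def)

lemma zero_notin_entries [simp]: "0 \<notin> entries c"
  by (simp add: entries_def)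

lemma entries_eq_image: "entries c = c ` {i. 0 < c i}"
  by (auto simp: entries_def)

lemma finite_entries: "column_inj c \<Longrightarrow> finite (entries c)"
  by (simp add: entries_eq_image column_inj_def)

lemma card_entries_ge:
  assumes "column_inj c" "0 < e"
  shows "card {x \<in> entries c. e \<le> x} = card {i. e \<le> c i}"
proof -
  have "{x \<in> entries c. e \<le> x} = c ` {i. e \<le> c i}" using assms(2) by (auto simp: entries_def)
  moreover have "inj_on c {i. e \<le> c i}"
    using assms by (auto simp: column_inj_def intro: inj_on_subset)
  ultimately show ?thesis by (simp add: card_image)
qed

lemma card_entries: "column_inj c \<Longrightarrow> card (entries c) = card {i. 0 < c i}"
  by (simp add: entries_eq_image column_inj_def card_image)

text \<open>
  If \<open>d i = d j > 0\<close> with \<open>i < j\<close>, then \<open>d j \<le> d i \<le> c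
  i\<close>, and the triple condition gives \<open>d j < d i\<close>.
\<close>

lemma column_inj_next_column:
  assumes "column_inj c" "next_column c d"
  shows "column_inj d"
  unfolding column_inj_def
proof
  have "{i. 0 < d i} \<subseteq> {i. 0 < c i}"
    using assms(2) unfolding next_column_def by (auto intro: less_le_trans)
  then show "finite {i. 0 < d i}" using assms(1) finite_subset by (auto simp: column_inj_def)
  show "inj_on d {i. 0 < d i}"
  proof (rule linorder_inj_onI')
    fix i j assume "i \<in> {i. 0 < d i}" "j \<in> {i. 0 < d i}" "i < j"
    then show "d i \<noteq> d j" using assms(2) unfolding next_column_def
      by (metis less_irrefl mem_Collect_eq)
  qed
qed

text \<open>
  Each entry \<open>\<ge> e\<close> of \<open>d\<close> has an entry \<open>\<ge> e\<close> of
  \<open>c\<close> in its row.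
\<close>

lemma dominates_if_le:
  assumes c: "column_inj c" and d: "column_inj d" and le: "\<And>i. d i \<le> c i"
  shows "dominates (entries c) (entries d)"
  unfolding dominates_def
proof (intro allI impI)
  fix e :: nat assume e: "0 < e"
  have "{i. e \<le> d i} \<subseteq> {i. e \<le> c i}" using le by (auto intro: order_trans)
  moreover have "finite {i. e \<le> c i}"
    by (rule finite_subset[of _ "{i. 0 < c i}"]) (use c e in \<open>auto simp: column_inj_def\<close>)
  ultimately show "card {x \<in> entries d. e \<le> x} \<le> card {x \<in> entries c. e \<le> x}"
    by (simp add: card_entries_ge[OF c e] card_entries_ge[OF d e] card_mono)
qed

text \<open>
  The greedy step of Mason's bijection. By the triple condition, an entry \<open>b\<close> may
  only skip a row \<open>i\<close> with \<open>c i \<ge> b\<close> if that row receives a larger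
  entry; so, once the larger entries are placed, \<open>b\<close> goes to the first free row that
  admits it. The induction adds the entries in decreasing order: the new entry \<open>b\<close> is
  smaller than those in \<open>A\<close>. Domination says that a row is always left.
\<close>

lemma ex1_next_column:
  assumes c: "column_inj c" and "finite E" "0 \<notin> E" "dominates (entries c) E"
  shows "\<exists>!d. next_column c d \<and> entries d = E"
  using assms(2-4)
proof (induction E rule: finite_linorder_min_induct)
  case empty
  have "entries d = {} \<longleftrightarrow> d = (\<lambda>_. 0)" for d
    by (auto simp: entries_def fun_eq_iff)
  then show ?case by (auto simp: next_column_def)
next
  case (insert b A)
  have b: "0 < b" and A: "0 \<notin> A" using insert.prems by auto
  have "dominates (entries c) A"
    unfolding dominates_def
  proof (intro allI impI)
    fix e :: nat assume "0 < e"
    have "card {x \<in> A. e \<le> x} \<le> card {x \<in> insert b A. e \<le> x}"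
      using insert.hyps(1) by (intro card_mono) auto
    also have "\<dots> \<le> card {x \<in> entries c. e \<le> x}"
      using insert.prems(2) \<open>0 < e\<close> by (auto simp: dominates_def)
    finally show "card {x \<in> A. e \<le> x} \<le> card {x \<in> entries c. e \<le> x}" .
  qed
  then obtain d0 where d0: "next_column c d0" "entries d0 = A"
    and uniq: "\<And>d. next_column c d \<Longrightarrow> entries d = A \<Longrightarrow> d = d0"
    using insert.IH A by blast
  have d0_A: "b < d0 i" if "d0 i \<noteq> 0" for i
  proof -
    have "d0 i \<in> A" using that d0(2) by (auto simp: entries_iff)
    then show ?thesis using insert.hyps(2) by blast
  qed
  have d0_le: "d0 i \<le> c i" for i using d0(1) by (simp add: next_column_def)
  have d0_rule: "d0 j < d0 i" if "i < j" "0 < d0 j" "d0 j \<le> c i" for i j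
    using d0(1) that by (simp add: next_column_def)
  \<comment> \<open>All rows used so far admit \<open>b\<close>; domination provides at least one row more.\<close>
  have "\<exists>i. d0 i = 0 \<and> b \<le> c i"
  proof (rule ccontr)
    assume "\<not> ?thesis"
    then have "{i. b \<le> c i} \<subseteq> {i. 0 < d0 i}" by auto
    moreover have fin: "finite {i. 0 < d0 i}"
      using column_inj_next_column[OF c d0(1)] by (simp add: column_inj_def)
    ultimately have "card {i. b \<le> c i} \<le> card {i. 0 < d0 i}" by (intro card_mono)
    also have "\<dots> = card A" using card_entries[OF column_inj_next_column[OF c d0(1)]] d0(2) by simp
    finally have 1: "card {i. b \<le> c i} \<le> card A" .
    have "{x \<in> insert b A. b \<le> x} = insert b A" using insert.hyps(2) by auto
    then have "card (insert b A) \<le> card {x \<in> entries c. b \<le> x}"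
      using insert.prems(2) b unfolding dominates_def by metis
    then have "card (insert b A) \<le> card A" using 1 card_entries_ge[OF c b] by simp
    then show False using insert.hyps by auto
  qed
  define i0 where "i0 = (LEAST i. d0 i = 0 \<and> b \<le> c i)"
  have i0: "d0 i0 = 0" "b \<le> c i0"
    using LeastI_ex[OF \<open>\<exists>i. d0 i = 0 \<and> b \<le> c i\<close>] by (auto simp: i0_def)
  have least: "d0 i \<noteq> 0" if "i < i0" "b \<le> c i" for i
    using not_less_Least[of i "\<lambda>i. d0 i = 0 \<and> b \<le> c i"] that by (auto simp: i0_def)
  let ?d = "d0(i0 := b)"
  have "next_column c ?d"
    unfolding next_column_def
  proof (intro conjI allI impI)
    show "?d i \<le> c i" for i using d0_le i0 by simp
    fix i j assume ij: "i < j" "0 < ?d j" "?d j \<le> c i"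
    show "?d j < ?d i"
    proof (cases "j = i0")
      case True
      then show ?thesis using ij least[of i] d0_A[of i] by simp
    next
      case False
      then have "d0 j < d0 i" using ij d0_rule[of i j] by simp
      then have "i \<noteq> i0" using i0 by auto
      then show ?thesis using \<open>d0 j < d0 i\<close> False by simp
    qed
  qed
  moreover have "entries ?d = insert b A"
  proof -
    have "entries ?d = insert b (entries d0)"
    proof (intro set_eqI iffI)
      fix x assume "x \<in> entries ?d"
      then show "x \<in> insert b (entries d0)" by (auto simp: entries_iff split: if_splits)
    next
      fix x assume x: "x \<in> insert b (entries d0)"
      show "x \<in> entries ?d"
      proof (cases "x = b")
        case False
        then obtain i where "0 < x" "d0 i = x" using x by (auto simp: entries_iff)
        then have "?d i = x" using i0 by auto
        then show ?thesis using \<open>0 < x\<close> by (auto simp: entries_iff)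
      next
        case True
        then show ?thesis unfolding entries_iff using b by (intro conjI exI[of _ i0]) auto
      qed
    qed
    then show ?thesis using d0 by simp
  qed
  moreover have "d = ?d" if d: "next_column c d" "entries d = insert b A" for d
  proof -
    have inj: "inj_on d {i. 0 < d i}"
      using column_inj_next_column[OF c d(1)] by (simp add: column_inj_def)
    have "b \<in> entries d" using d(2) by simp
    then obtain i' where i': "d i' = b" by (auto simp: entries_iff)
    have d_ge: "b \<le> d j" if "0 < d j" for j
    proof -
      have "d j \<in> entries d" using that by (auto simp: entries_iff)
      then have "d j = b \<or> d j \<in> A" unfolding d(2) by blast
      then show ?thesis using insert.hyps(2) by auto
    qed
    \<comment> \<open>Erasing the smallest entry \<open>b\<close> leaves a solution for \<open>A\<close>, as no triple condition relies on \<open>b\<close> being the larger entry.\<close>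
    let ?e = "d(i' := 0)"
    have "next_column c ?e"
      unfolding next_column_def
    proof (intro conjI allI impI)
      show "?e i \<le> c i" for i using d(1) by (simp add: next_column_def)
      fix i j assume ij: "i < j" "0 < ?e j" "?e j \<le> c i"
      then have j: "j \<noteq> i'" "0 < d j" "d j \<le> c i" by (auto split: if_splits)
      then have "d j < d i" using d(1) ij(1) by (simp add: next_column_def)
      then have "i \<noteq> i'" using d_ge[OF j(2)] i' by auto
      then show "?e j < ?e i" using j \<open>d j < d i\<close> by simp
    qed
    moreover have "entries ?e = A"
    proof (intro set_eqI iffI)
      fix x assume "x \<in> entries ?e"
      then obtain i where i: "i \<noteq> i'" "d i = x" "0 < x" by (auto simp: entries_iff split: if_splits)
      then have "x \<in> entries d" unfolding entries_iff by blast
      then have "x = b \<or> x \<in> A" unfolding d(2) by blast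
      moreover have "x \<noteq> b"
      proof
        assume "x = b"
        then have "i = i'" using inj_onD[OF inj, of i i'] i(2) i' b by simp
        then show False using i(1) by simp
      qed
      ultimately show "x \<in> A" by simp
    next
      fix x assume x: "x \<in> A"
      then have "x \<in> entries d" using d(2) by simp
      then obtain i where i: "d i = x" "0 < x" by (auto simp: entries_iff)
      have "x \<noteq> b" using x insert.hyps(2) by auto
      then have "?e i = x" using i i' by auto
      then show "x \<in> entries ?e" unfolding entries_iff using i by blast
    qed
    ultimately have e: "?e = d0" by (rule uniq)
    have e_eq: "d0 i = (if i = i' then 0 else d i)" for i unfolding e[symmetric] by simp
    have "i0 = i'"
      unfolding i0_def
    proof (rule Least_equality)
      have "d i' \<le> c i'" using d(1) by (simp add: next_column_def)
      then show "d0 i' = 0 \<and> b \<le> c i'" using i' e_eq by simp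
      fix i assume i: "d0 i = 0 \<and> b \<le> c i"
      show "i' \<le> i"
      proof (rule ccontr)
        assume "\<not> i' \<le> i"
        then have "i < i'" "0 < d i'" "d i' \<le> c i" using i i' b by simp_all
        then have "d i' < d i" using d(1) unfolding next_column_def by blast
        then show False using i e_eq[of i] \<open>\<not> i' \<le> i\<close> by auto
      qed
    qed
    then show "d = ?d" using e_eq i' by (auto simp: fun_eq_iff)
  qed
  ultimately show ?case by (intro ex1I[of _ ?d]) blast+
qed

lemma initial_segment_eq_card:
  fixes S :: "nat set"
  assumes "finite S" "\<And>i j. i < j \<Longrightarrow> j \<in> S \<Longrightarrow> i \<in> S"
  shows "S = {..<card S}"
proof -
  have "\<exists>i. i \<notin> S" using assms(1) by (metis ex_new_if_finite infinite_UNIV_nat)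
  define L where "L = (LEAST i. i \<notin> S)"
  have "L \<notin> S" unfolding L_def by (rule LeastI_ex) fact
  moreover have "i \<in> S" if "i < L" for i using that not_less_Least unfolding L_def by blast
  ultimately have "S = {..<L}" using assms(2) by (metis lessThan_iff linorder_neqE_nat set_eqI)
  then show ?thesis by simp
qed

definition increasing_column :: "(nat \<Rightarrow> nat) \<Rightarrow> bool" where
  "increasing_column c \<longleftrightarrow>
    (\<exists>L. (\<forall>i. 0 < c i \<longleftrightarrow> i < L) \<and> (\<forall>i j. i < j \<longrightarrow> j < L \<longrightarrow> c i < c j))"

definition decreasing_column :: "(nat \<Rightarrow> nat) \<Rightarrow> bool" where
  "decreasing_column c \<longleftrightarrow> finite {i. 0 < c i} \<and> (\<forall>i j. i < j \<longrightarrow> 0 < c j \<longrightarrow> c j < c i)"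

definition padded_list :: "nat list \<Rightarrow> nat \<Rightarrow> nat" where
  "padded_list xs i = (if i < length xs then xs ! i else 0)"

lemma entries_padded_list: "0 \<notin> set xs \<Longrightarrow> entries (padded_list xs) = set xs"
  by (auto simp: entries_iff padded_list_def in_set_conv_nth split: if_splits)

lemma column_inj_increasing: "increasing_column c \<Longrightarrow> column_inj c"
  unfolding column_inj_def increasing_column_def
  by (auto intro!: linorder_inj_onI' simp flip: lessThan_def) (metis less_irrefl)

lemma column_inj_decreasing: "decreasing_column c \<Longrightarrow> column_inj c"
  unfolding column_inj_def decreasing_column_def
  by (auto intro!: linorder_inj_onI') (metis less_irrefl)

text \<open>
  The listing of \<open>E\<close> in increasing order is the only possibility.
\<close>

lemma ex1_increasing_column:
  assumes "finite E" "0 \<notin> E"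
  shows "\<exists>!c. increasing_column c \<and> entries c = E"
proof (rule ex1I)
  let ?xs = "sorted_list_of_set E"
  have set: "set ?xs = E" using assms by simp
  have "0 < ?xs ! i" if "i < length ?xs" for i using that nth_mem[OF that] set assms by (metis gr0I)
  moreover have "sorted_wrt (<) ?xs" by simp
  ultimately show "increasing_column (padded_list ?xs) \<and> entries (padded_list ?xs) = E"
    using entries_padded_list[of ?xs] set assms
    by (auto simp: increasing_column_def padded_list_def sorted_wrt_iff_nth_less
        intro!: exI[of _ "length ?xs"])
  fix c assume c: "increasing_column c \<and> entries c = E"
  then obtain L where L: "\<forall>i. 0 < c i \<longleftrightarrow> i < L" "\<forall>i j. i < j \<longrightarrow> j < L \<longrightarrow> c i < c j"
    by (auto simp: increasing_column_def)
  have "sorted_wrt (<) (map c [0..<L])" using L by (auto simp: sorted_wrt_iff_nth_less)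
  moreover have "set (map c [0..<L]) = E"
    using c L(1) by (auto simp: entries_eq_image)
  ultimately have "?xs = map c [0..<L]"
    by (metis sorted_list_of_set.idem_if_sorted_distinct strict_sorted_iff)
  then show "c = padded_list ?xs" using L(1) by (auto simp: padded_list_def fun_eq_iff)
qed

lemma support_decreasing_column:
  assumes "decreasing_column c"
  shows "0 < c i \<longleftrightarrow> i < card (entries c)"
proof -
  have "{i. 0 < c i} = {..<card {i. 0 < c i}}"
    by (rule initial_segment_eq_card)
      (use assms in \<open>auto simp: decreasing_column_def intro: less_trans\<close>)
  then show ?thesis using card_entries[OF column_inj_decreasing[OF assms]] by auto
qed

lemma ex1_decreasing_column:
  assumes "finite E" "0 \<notin> E"
  shows "\<exists>!c. decreasing_column c \<and> entries c = E"
proof (rule ex1I)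
  let ?xs = "sorted_list_of_set E"
  have set: "set (rev ?xs) = E" using assms by simp
  have "sorted_wrt (>) (rev ?xs)" by (simp add: sorted_wrt_rev)
  moreover have "finite {i. 0 < padded_list (rev ?xs) i}"
    by (rule finite_subset[of _ "{..<length ?xs}"]) (auto simp: padded_list_def)
  ultimately show "decreasing_column (padded_list (rev ?xs)) \<and> entries (padded_list (rev ?xs)) = E"
    using entries_padded_list[of "rev ?xs"] set assms
    by (auto simp: decreasing_column_def padded_list_def sorted_wrt_iff_nth_less simp del: set_rev length_rev)
  fix c assume c: "decreasing_column c \<and> entries c = E"
  let ?L = "card E"
  have L: "0 < c i \<longleftrightarrow> i < ?L" for i using support_decreasing_column c by blast
  have "sorted_wrt (>) (map c [0..<?L])" 
    using c L by (auto simp: sorted_wrt_iff_nth_less decreasing_column_def)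
  then have "sorted_wrt (<) (rev (map c [0..<?L]))" by (simp add: sorted_wrt_rev)
  moreover have "set (rev (map c [0..<?L])) = E"
    using c L by (auto simp: entries_eq_image atLeast0LessThan lessThan_def)
  ultimately have "?xs = rev (map c [0..<?L])"
    by (metis sorted_list_of_set.idem_if_sorted_distinct strict_sorted_iff)
  then have "rev ?xs = map c [0..<?L]" by simp
  then show "c = padded_list (rev ?xs)" using L by (auto simp: padded_list_def fun_eq_iff)
qed

text \<open>
  If \<open>d i > c i\<close>, then at least \<open>i + 1\<close> entries of \<open>d\<close> but
  at most \<open>i\<close> entries of \<open>c\<close> are \<open>\<ge> d i\<close>; rows are
  counted from \<open>0\<close>.
\<close>

lemma le_if_dominates:
  assumes c: "decreasing_column c" and d: "decreasing_column d"
    and dom: "dominates (entries c) (entries d)"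
  shows "d i \<le> c i"
proof (rule ccontr)
  assume "\<not> d i \<le> c i"
  then have less: "c i < d i" by simp
  then have e: "0 < d i" by simp
  have fin: "finite {j. d i \<le> d j}"
    by (rule finite_subset[of _ "{j. 0 < d j}"]) (use d e in \<open>auto simp: decreasing_column_def\<close>)
  have "{..i} \<subseteq> {j. d i \<le> d j}"
  proof
    fix j assume "j \<in> {..i}"
    then consider "j = i" | "j < i" by fastforce
    then show "j \<in> {j. d i \<le> d j}"
      using d e by cases (auto simp: decreasing_column_def intro: less_imp_le)
  qed
  from card_mono[OF fin this] have "Suc i \<le> card {j. d i \<le> d j}" by simp
  also have "\<dots> \<le> card {j. d i \<le> c j}"
    using dom e unfolding dominates_def
    by (simp flip: card_entries_ge[OF column_inj_decreasing[OF c] e]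
        card_entries_ge[OF column_inj_decreasing[OF d] e])
  also have "\<dots> \<le> card {..<i}"
  proof (rule card_mono)
    show "{j. d i \<le> c j} \<subseteq> {..<i}"
    proof
      fix j assume j: "j \<in> {j. d i \<le> c j}"
      then have "0 < c j" "c i < c j" using e less by auto
      have "\<not> i < j"
      proof
        assume "i < j"
        then have "c j < c i" using c \<open>0 < c j\<close> by (simp add: decreasing_column_def)
        then show False using \<open>c i < c j\<close> by simp
      qed
      moreover have "i \<noteq> j" using \<open>c i < c j\<close> by blast
      ultimately show "j \<in> {..<i}" by simp
    qed
  qed simp
  finally show False by simp
qed

section \<open>Mason's correspondence for arrays\<close>

definition eventually_empty :: "(nat \<Rightarrow> nat set) \<Rightarrow> bool" where
  "eventually_empty E \<longleftrightarrow> (\<exists>N. \<forall>k\<ge>N. E k = {})"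

text \<open>
  SSCT and SSRT of unspecified shape: \<open>t k i\<close> is the entry of the cell in row
  \<open>i\<close> and column \<open>k\<close>, and \<open>0\<close> if there is no such cell.
\<close>

definition composition_array :: "(nat \<Rightarrow> nat \<Rightarrow> nat) \<Rightarrow> bool" where
  "composition_array t \<longleftrightarrow> increasing_column (t 0) \<and> (\<forall>k. next_column (t k) (t (Suc k))) \<and>
    eventually_empty (\<lambda>k. entries (t k))"

definition reverse_array :: "(nat \<Rightarrow> nat \<Rightarrow> nat) \<Rightarrow> bool" where
  "reverse_array t \<longleftrightarrow> (\<forall>k. decreasing_column (t k)) \<and> (\<forall>k i. t (Suc k) i \<le> t k i) \<and>
    eventually_empty (\<lambda>k. entries (t k))"

definition dominance_chain :: "(nat \<Rightarrow> nat set) \<Rightarrow> bool" where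
  "dominance_chain E \<longleftrightarrow> (\<forall>k. finite (E k) \<and> 0 \<notin> E k \<and> dominates (E k) (E (Suc k))) \<and>
    eventually_empty E"

lemma column_inj_composition_array:
  assumes t: "composition_array t"
  shows "column_inj (t k)"
proof (induction k)
  case 0
  then show ?case using t column_inj_increasing by (simp add: composition_array_def)
next
  case (Suc k)
  have "next_column (t k) (t (Suc k))" using t by (simp add: composition_array_def)
  with Suc show ?case by (rule column_inj_next_column)
qed

lemma column_inj_reverse_array: "reverse_array t \<Longrightarrow> column_inj (t k)"
  by (simp add: reverse_array_def column_inj_decreasing)

lemma dominance_chain_composition_array:
  assumes "composition_array t"
  shows "dominance_chain (\<lambda>k. entries (t k))"
proof -
  note inj = column_inj_composition_array[OF assms]
  have "dominates (entries (t k)) (entries (t (Suc k)))" for k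
    using assms by (intro dominates_if_le inj) (auto simp: composition_array_def next_column_def)
  then show ?thesis
    using assms finite_entries[OF inj] by (simp add: dominance_chain_def composition_array_def)
qed

lemma dominance_chain_reverse_array:
  assumes "reverse_array t"
  shows "dominance_chain (\<lambda>k. entries (t k))"
proof -
  note inj = column_inj_reverse_array[OF assms]
  have "dominates (entries (t k)) (entries (t (Suc k)))" for k
    using assms by (intro dominates_if_le inj) (auto simp: reverse_array_def)
  then show ?thesis
    using assms finite_entries[OF inj] by (simp add: dominance_chain_def reverse_array_def)
qed

text \<open>
  The columns are determined one after the other, from left to right, by
  \<open>ex1_next_column\<close>.
\<close>

lemma ex1_composition_array:
  assumes E: "dominance_chain E"
  shows "\<exists>!t. composition_array t \<and> (\<forall>k. entries (t k) = E k)"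
proof -
  have fin: "finite (E k)" and zero: "0 \<notin> E k" and dom: "dominates (E k) (E (Suc k))" for k
    using E by (auto simp: dominance_chain_def)
  have "\<exists>t. \<forall>k. (column_inj (t k) \<and> entries (t k) = E k \<and> (k = 0 \<longrightarrow> increasing_column (t k))) \<and>
      next_column (t k) (t (Suc k))"
  proof (rule dependent_nat_choice)
    show "\<exists>c. column_inj c \<and> entries c = E 0 \<and> (0 = (0::nat) \<longrightarrow> increasing_column c)"
      using ex1_increasing_column[OF fin zero, of 0] column_inj_increasing by blast
    fix c k assume c: "column_inj c \<and> entries c = E k \<and> (k = 0 \<longrightarrow> increasing_column c)"
    then obtain d where "next_column c d" "entries d = E (Suc k)"
      using ex1_next_column[of c "E (Suc k)"] fin zero dom[of k] by auto
    then show "\<exists>d. (column_inj d \<and> entries d = E (Suc k) \<and> (Suc k = 0 \<longrightarrow> increasing_column d)) \<and>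
        next_column c d"
      using c column_inj_next_column by blast
  qed
  then obtain t where t: "\<And>k. entries (t k) = E k" "increasing_column (t 0)"
    "\<And>k. next_column (t k) (t (Suc k))"
    by blast
  show ?thesis
  proof (rule ex1I)
    show "composition_array t \<and> (\<forall>k. entries (t k) = E k)"
      using t E by (simp add: composition_array_def dominance_chain_def)
    fix s assume s: "composition_array s \<and> (\<forall>k. entries (s k) = E k)"
    have "s k = t k" for k
    proof (induction k)
      case 0
      have "increasing_column (s 0) \<and> entries (s 0) = E 0" using s by (simp add: composition_array_def)
      moreover have "increasing_column (t 0) \<and> entries (t 0) = E 0" using t by simp
      ultimately show ?case using ex1_increasing_column[OF fin zero, of 0] by blast
    next
      case (Suc k)
      have inj: "column_inj (t k)" using column_inj_composition_array[of s k] s Suc by simp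
      have "\<exists>!d. next_column (t k) d \<and> entries d = E (Suc k)"
        by (rule ex1_next_column) (use inj fin zero dom t in auto)
      moreover have "next_column (t k) (s (Suc k)) \<and> entries (s (Suc k)) = E (Suc k)"
        using s by (simp add: composition_array_def flip: Suc)
      moreover have "next_column (t k) (t (Suc k)) \<and> entries (t (Suc k)) = E (Suc k)" using t by simp
      ultimately show ?case by blast
    qed
    then show "s = t" by blast
  qed
qed

text \<open>
  Here each column is determined by its own set, and domination is the row condition.
\<close>

lemma ex1_reverse_array:
  assumes E: "dominance_chain E"
  shows "\<exists>!t. reverse_array t \<and> (\<forall>k. entries (t k) = E k)"
proof -
  have "\<exists>!c. decreasing_column c \<and> entries c = E k" for k
    using E by (intro ex1_decreasing_column) (auto simp: dominance_chain_def)
  then obtain t where t: "\<And>k. decreasing_column (t k) \<and> entries (t k) = E k"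
    and uniq: "\<And>k c. decreasing_column c \<and> entries c = E k \<Longrightarrow> c = t k"
    by metis
  show ?thesis
  proof (rule ex1I)
    have "t (Suc k) i \<le> t k i" for k i
      using t E by (intro le_if_dominates) (auto simp: dominance_chain_def)
    then show "reverse_array t \<and> (\<forall>k. entries (t k) = E k)"
      using t E by (simp add: reverse_array_def dominance_chain_def)
    fix s assume "reverse_array s \<and> (\<forall>k. entries (s k) = E k)"
    then show "s = t" using uniq by (auto simp: reverse_array_def)
  qed
qed

section \<open>Tableaux as arrays\<close>

definition pad :: "nat list \<Rightarrow> (nat \<times> nat \<Rightarrow> nat) \<Rightarrow> nat \<Rightarrow> nat \<Rightarrow> nat" where
  "pad \<alpha> T k i = (if (i, k) \<in> diagram \<alpha> then T (i, k) else 0)"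

definition column_sets :: "nat list \<Rightarrow> (nat \<times> nat \<Rightarrow> nat) \<Rightarrow> nat \<Rightarrow> nat set" where
  "column_sets \<alpha> T k = entries (pad \<alpha> T k)"

definition column_length :: "nat list \<Rightarrow> nat \<Rightarrow> nat" where
  "column_length \<alpha> k = card {i. (i, k) \<in> diagram \<alpha>}"

lemma tableau_positive:
  fixes T :: "nat \<times> nat \<Rightarrow> nat"
  assumes "T \<in> diagram \<alpha> \<rightarrow>\<^sub>E {1..}" "c \<in> diagram \<alpha>"
  shows "0 < T c"
  using PiE_mem[OF assms] by simp

lemma pad_pos_iff:
  assumes "T \<in> diagram \<alpha> \<rightarrow>\<^sub>E {1..}"
  shows "0 < pad \<alpha> T k i \<longleftrightarrow> (i, k) \<in> diagram \<alpha>"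
  using tableau_positive[OF assms] by (simp add: pad_def)

lemma eventually_empty_pad: "eventually_empty (\<lambda>k. entries (pad \<alpha> T k))"
  unfolding eventually_empty_def
proof (intro exI allI impI)
  fix k assume "sum_list \<alpha> \<le> k"
  then have "(i, k) \<notin> diagram \<alpha>" for i
    using elem_le_sum_list[of i \<alpha>] by (auto simp: diagram_def)
  then show "entries (pad \<alpha> T k) = {}" by (auto simp: entries_def pad_def)
qed

lemma diagram_left: "(i, l) \<in> diagram \<alpha> \<Longrightarrow> k \<le> l \<Longrightarrow> (i, k) \<in> diagram \<alpha>"
  by (auto simp: diagram_def)

lemma composition_array_pad:
  assumes \<alpha>: "is_composition \<alpha>" and T: "T \<in> SSCT \<alpha>"
  shows "composition_array (pad \<alpha> T)"
  unfolding composition_array_def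
proof (intro conjI allI)
  let ?D = "diagram \<alpha>"
  have PiE: "T \<in> ?D \<rightarrow>\<^sub>E {1..}" and rows: "rows_weakly_decreasing \<alpha> T"
    and first: "\<And>i j. i < j \<Longrightarrow> (i, 0) \<in> ?D \<Longrightarrow> (j, 0) \<in> ?D \<Longrightarrow> T (i, 0) < T (j, 0)"
    and rule: "\<And>i j k. i < j \<Longrightarrow> (i, k) \<in> ?D \<Longrightarrow> (j, k + 1) \<in> ?D \<Longrightarrow> T (j, k + 1) \<le> T (i, k) \<Longrightarrow>
        (i, k + 1) \<in> ?D \<and> T (j, k + 1) < T (i, k + 1)"
    using T unfolding SSCT_def by blast+
  have D0: "(i, 0) \<in> ?D \<longleftrightarrow> i < length \<alpha>" for i
    using \<alpha> by (auto simp: diagram_def is_composition_def)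
  show "increasing_column (pad \<alpha> T 0)"
    unfolding increasing_column_def
  proof (intro exI[of _ "length \<alpha>"] conjI allI impI)
    show "0 < pad \<alpha> T 0 i \<longleftrightarrow> i < length \<alpha>" for i by (simp add: pad_pos_iff[OF PiE] D0)
    show "pad \<alpha> T 0 i < pad \<alpha> T 0 j" if "i < j" "j < length \<alpha>" for i j
      using first[OF that(1)] that D0 by (simp add: pad_def)
  qed
  fix k
  show "next_column (pad \<alpha> T k) (pad \<alpha> T (Suc k))"
    unfolding next_column_def
  proof (intro conjI allI impI)
    show "pad \<alpha> T (Suc k) i \<le> pad \<alpha> T k i" for i
    proof (cases "(i, Suc k) \<in> ?D")
      case True
      then have "(i, k) \<in> ?D" by (rule diagram_left) simp
      then show ?thesis using True rows by (simp add: pad_def rows_weakly_decreasing_def)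
    qed (simp add: pad_def)
    fix i j assume ij: "i < j" "0 < pad \<alpha> T (Suc k) j" "pad \<alpha> T (Suc k) j \<le> pad \<alpha> T k i"
    then have "(j, Suc k) \<in> ?D" by (simp add: pad_pos_iff[OF PiE])
    moreover have "(i, k) \<in> ?D" using ij pad_pos_iff[OF PiE, of k i] by linarith
    ultimately show "pad \<alpha> T (Suc k) j < pad \<alpha> T (Suc k) i"
      using ij rule[of i j k] by (simp add: pad_def)
  qed
qed (rule eventually_empty_pad)

text \<open>
  Row lengths of an array are recovered as numbers of positive entries.
\<close>

lemma row_initial:
  assumes le: "\<And>k. t (Suc k) i \<le> t k i" and ev: "eventually_empty (\<lambda>k. entries (t k))"
  shows "0 < t k i \<longleftrightarrow> k < card {k. 0 < t k i}"
proof -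
  obtain N where N: "\<And>k. N \<le> k \<Longrightarrow> entries (t k) = {}"
    using ev by (auto simp: eventually_empty_def)
  have "t k i = 0" if "N \<le> k" for k
  proof (rule ccontr)
    assume "t k i \<noteq> 0"
    then have "t k i \<in> entries (t k)" by (auto simp: entries_iff)
    then show False using N[OF that] by simp
  qed
  then have "{k. 0 < t k i} \<subseteq> {..<N}" by (metis (no_types, lifting) less_irrefl lessThan_iff mem_Collect_eq not_less subsetI)
  then have fin: "finite {k. 0 < t k i}" using finite_subset by blast
  have anti: "t l i \<le> t k i" if "k \<le> l" for k l
    using lift_Suc_antimono_le[of "\<lambda>k. t k i", OF le that] .
  have "{k. 0 < t k i} = {..<card {k. 0 < t k i}}"
    by (rule initial_segment_eq_card[OF fin]) (use anti in \<open>auto intro: less_le_trans less_imp_le\<close>)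
  then show ?thesis by blast
qed

text \<open>
  The shape is read off from the positions of the positive entries; it is a composition because
  the rows with a cell in the first column are initial and contain all other cells.
\<close>

lemma tableau_of_composition_array:
  assumes t: "composition_array t"
  obtains \<gamma> T where "is_composition \<gamma>" "T \<in> SSCT \<gamma>" "pad \<gamma> T = t"
proof -
  have next_col: "next_column (t k) (t (Suc k))" for k using t by (simp add: composition_array_def)
  obtain L where L: "\<And>i. 0 < t 0 i \<longleftrightarrow> i < L" "\<And>i j. i < j \<Longrightarrow> j < L \<Longrightarrow> t 0 i < t 0 j"
    using t by (auto simp: composition_array_def increasing_column_def)
  have le: "t (Suc k) i \<le> t k i" for k i using next_col[of k] by (simp add: next_column_def)
  have anti: "t l i \<le> t k i" if "k \<le> l" for k l i
    using lift_Suc_antimono_le[of "\<lambda>k. t k i", OF le that] .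
  define \<gamma> where "\<gamma> = map (\<lambda>i. card {k. 0 < t k i}) [0..<L]"
  have row: "0 < t k i \<longleftrightarrow> k < card {k. 0 < t k i}" for k i
    using t by (intro row_initial le) (simp add: composition_array_def)
  have D: "(i, k) \<in> diagram \<gamma> \<longleftrightarrow> 0 < t k i" for i k
  proof
    assume "(i, k) \<in> diagram \<gamma>"
    then show "0 < t k i" using row[of k i] by (auto simp: diagram_def \<gamma>_def)
  next
    assume pos: "0 < t k i"
    then have "0 < t 0 i" using anti[of 0 k i] by simp
    then show "(i, k) \<in> diagram \<gamma>" using pos L(1) row[of k i] by (auto simp: diagram_def \<gamma>_def)
  qed
  define T where "T = restrict (\<lambda>(i, k). t k i) (diagram \<gamma>)"
  have T: "T (i, k) = t k i" if "(i, k) \<in> diagram \<gamma>" for i k using that by (simp add: T_def)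
  show thesis
  proof
    show "is_composition \<gamma>"
      unfolding is_composition_def
    proof
      fix a assume "a \<in> set \<gamma>"
      then obtain i where "i < L" "a = card {k. 0 < t k i}" by (auto simp: \<gamma>_def)
      then show "0 < a" using L(1)[of i] row[of 0 i] by simp
    qed
    show "pad \<gamma> T = t"
    proof (intro ext)
      show "pad \<gamma> T k i = t k i" for k i
        using D[of i k] T[of i k] by (cases "(i, k) \<in> diagram \<gamma>") (auto simp: pad_def)
    qed
    show "T \<in> SSCT \<gamma>"
      unfolding SSCT_def mem_Collect_eq
    proof (intro conjI allI impI)
      show "T \<in> diagram \<gamma> \<rightarrow>\<^sub>E {1..}"
        using D by (auto simp: T_def Suc_le_eq)
      show "rows_weakly_decreasing \<gamma> T"
        using anti T by (simp add: rows_weakly_decreasing_def)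
      show "T (i, 0) < T (j, 0)" if "i < j \<and> (i, 0) \<in> diagram \<gamma> \<and> (j, 0) \<in> diagram \<gamma>" for i j
        using that L D T by simp
      fix i j k
      assume h: "i < j \<and> (i, k) \<in> diagram \<gamma> \<and> (j, k + 1) \<in> diagram \<gamma> \<and> T (j, k + 1) \<le> T (i, k)"
      then have "0 < t (k + 1) j" "t (k + 1) j \<le> t k i" using D T by metis+
      then have less: "t (k + 1) j < t (k + 1) i"
        using next_col[of k] h unfolding next_column_def by simp
      then show i: "(i, k + 1) \<in> diagram \<gamma>" using D by simp
      show "T (j, k + 1) < T (i, k + 1)" using less T[OF i] h T by simp
    qed
  qed
qed

lemma composition_eqI_diagram:
  assumes "is_composition \<alpha>" "is_composition \<beta>" and eq: "diagram \<alpha> = diagram \<beta>"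
  shows "\<alpha> = \<beta>"
proof (rule nth_equalityI)
  have "i < length \<gamma> \<longleftrightarrow> (i, 0) \<in> diagram \<gamma>" if "is_composition \<gamma>" for i \<gamma>
    using that by (auto simp: diagram_def is_composition_def)
  then have len: "i < length \<alpha> \<longleftrightarrow> i < length \<beta>" for i using assms by simp
  then show "length \<alpha> = length \<beta>" by (meson linorder_neqE_nat less_irrefl)
  fix i assume i: "i < length \<alpha>"
  have "k < \<alpha> ! i \<longleftrightarrow> k < \<beta> ! i" for k
  proof -
    have "(i, k) \<in> diagram \<alpha> \<longleftrightarrow> (i, k) \<in> diagram \<beta>" using eq by simp
    then show ?thesis using i len by (simp add: diagram_def)
  qed
  then show "\<alpha> ! i = \<beta> ! i" by (meson linorder_neqE_nat less_irrefl)
qed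

lemma pad_inject:
  assumes "S \<in> diagram \<alpha> \<rightarrow>\<^sub>E {1..}" "T \<in> diagram \<beta> \<rightarrow>\<^sub>E {1..}" and eq: "pad \<alpha> S = pad \<beta> T"
  shows "diagram \<alpha> = diagram \<beta>" "S = T"
proof -
  show D: "diagram \<alpha> = diagram \<beta>"
    using pad_pos_iff[OF assms(1)] pad_pos_iff[OF assms(2)] eq by (metis subrelI subset_antisym)
  show "S = T"
  proof (rule extensionalityI[of S "diagram \<alpha>" T])
    show "S \<in> extensional (diagram \<alpha>)" "T \<in> extensional (diagram \<alpha>)"
      using assms D by (auto simp: PiE_def)
    fix c assume c: "c \<in> diagram \<alpha>"
    obtain i k where ik: "c = (i, k)" by (cases c)
    show "S c = T c"
      using fun_cong[OF fun_cong[OF eq, of k], of i] c D by (simp add: pad_def ik)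
  qed
qed

lemma partition_nth_mono:
  assumes "is_partition l" "i \<le> j" "j < length l"
  shows "l ! j \<le> l ! i"
  using assms by (cases "i = j") (auto simp: is_partition_def sorted_wrt_iff_nth_less)

lemma diagram_up:
  assumes "is_partition l" "(j, k) \<in> diagram l" "i \<le> j"
  shows "(i, k) \<in> diagram l"
  using assms partition_nth_mono[OF assms(1,3)] by (auto simp: diagram_def)

lemma finite_column: "finite {i. (i, k) \<in> diagram \<alpha>}"
  by (rule finite_subset[of _ "{..<length \<alpha>}"]) (auto simp: diagram_def)

lemma diagram_partition_iff:
  assumes "is_partition l"
  shows "(i, k) \<in> diagram l \<longleftrightarrow> i < column_length l k"
proof -
  have "{i. (i, k) \<in> diagram l} = {..<card {i. (i, k) \<in> diagram l}}"
    by (rule initial_segment_eq_card[OF finite_column])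
      (use diagram_up[OF assms] less_imp_le in blast)
  then show ?thesis by (auto simp: column_length_def)
qed

lemma reverse_array_pad:
  assumes l: "is_partition l" and T: "T \<in> SSRT l"
  shows "reverse_array (pad l T)"
  unfolding reverse_array_def
proof (intro conjI allI)
  let ?D = "diagram l"
  have PiE: "T \<in> ?D \<rightarrow>\<^sub>E {1..}" and rows: "rows_weakly_decreasing l T"
    and cols: "\<And>i j k. i < j \<Longrightarrow> (i, k) \<in> ?D \<Longrightarrow> (j, k) \<in> ?D \<Longrightarrow> T (j, k) < T (i, k)"
    using T unfolding SSRT_def by blast+
  show "decreasing_column (pad l T k)" for k
    unfolding decreasing_column_def
  proof (intro conjI allI impI)
    show "finite {i. 0 < pad l T k i}" by (simp add: pad_pos_iff[OF PiE] finite_column)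
    fix i j assume ij: "i < j" "0 < pad l T k j"
    then have j: "(j, k) \<in> ?D" by (simp add: pad_pos_iff[OF PiE])
    then have "(i, k) \<in> ?D" using diagram_up[OF l] ij(1) less_imp_le by blast
    then show "pad l T k j < pad l T k i" using cols[OF ij(1)] j by (simp add: pad_def)
  qed
  show "pad l T (Suc k) i \<le> pad l T k i" for k i
  proof (cases "(i, Suc k) \<in> ?D")
    case True
    then have "(i, k) \<in> ?D" by (rule diagram_left) simp
    then show ?thesis using True rows by (simp add: pad_def rows_weakly_decreasing_def)
  qed (simp add: pad_def)
qed (rule eventually_empty_pad)

text \<open>
  Columns of both \<open>l\<close> and \<open>t\<close> are initial segments, so equality of the
  column lengths makes the shapes agree.
\<close>

lemma tableau_of_reverse_array:
  assumes l: "is_partition l" and t: "reverse_array t"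
    and len: "\<And>k. card (entries (t k)) = column_length l k"
  obtains T where "T \<in> SSRT l" "pad l T = t"
proof -
  have dec: "decreasing_column (t k)" for k using t by (simp add: reverse_array_def)
  have D: "(i, k) \<in> diagram l \<longleftrightarrow> 0 < t k i" for i k
    using support_decreasing_column[OF dec] len by (simp add: diagram_partition_iff[OF l])
  have anti: "t k' i \<le> t k i" if "k \<le> k'" for k k' i
    using lift_Suc_antimono_le[of "\<lambda>k. t k i", OF _ that] t by (simp add: reverse_array_def)
  define T where "T = restrict (\<lambda>(i, k). t k i) (diagram l)"
  have T: "T (i, k) = t k i" if "(i, k) \<in> diagram l" for i k using that by (simp add: T_def)
  show thesis
  proof
    show "pad l T = t"
    proof (intro ext)
      show "pad l T k i = t k i" for k i
        using D[of i k] T[of i k] by (cases "(i, k) \<in> diagram l") (auto simp: pad_def)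
    qed
    show "T \<in> SSRT l"
      unfolding SSRT_def mem_Collect_eq
    proof (intro conjI allI impI)
      show "T \<in> diagram l \<rightarrow>\<^sub>E {1..}" using D by (auto simp: T_def Suc_le_eq)
      show "rows_weakly_decreasing l T"
        using anti T by (simp add: rows_weakly_decreasing_def)
      show "T (j, k) < T (i, k)" if "i < j \<and> (i, k) \<in> diagram l \<and> (j, k) \<in> diagram l" for i j k
        using that dec[of k] D T by (simp add: decreasing_column_def)
    qed
  qed
qed

lemma card_column_sets:
  assumes "T \<in> diagram \<alpha> \<rightarrow>\<^sub>E {1..}" "column_inj (pad \<alpha> T k)"
  shows "card (column_sets \<alpha> T k) = column_length \<alpha> k"
  unfolding column_sets_def column_length_def card_entries[OF assms(2)] pad_pos_iff[OF assms(1)] ..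

text \<open>
  Entries in a column are distinct, so the occurrences of \<open>v\<close> are counted by the
  columns that contain it.
\<close>

lemma count_content_column_sets:
  assumes T: "T \<in> diagram \<alpha> \<rightarrow>\<^sub>E {1..}" and inj: "\<And>k. column_inj (pad \<alpha> T k)" and "0 < v"
  shows "count (content \<alpha> T) v = card {k. v \<in> column_sets \<alpha> T k}"
proof -
  let ?C = "{c \<in> diagram \<alpha>. T c = v}"
  have "inj_on snd ?C"
  proof (rule inj_onI)
    fix c d assume c: "c \<in> ?C" and d: "d \<in> ?C" and eq: "snd c = snd d"
    obtain i k where ik: "c = (i, k)" by (cases c)
    obtain j where jk: "d = (j, k)" using eq ik by (cases d) simp
    have "i \<in> {i. 0 < pad \<alpha> T k i}" "j \<in> {i. 0 < pad \<alpha> T k i}" "pad \<alpha> T k i = pad \<alpha> T k j"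
      using c d assms(3) by (simp_all add: ik jk pad_def)
    then have "i = j" using inj[of k] unfolding column_inj_def by (meson inj_onD)
    then show "c = d" by (simp add: ik jk)
  qed
  moreover have "snd ` ?C = {k. v \<in> column_sets \<alpha> T k}"
    using \<open>0 < v\<close> by (force simp: column_sets_def entries_iff pad_def image_iff)
  ultimately have "card ?C = card {k. v \<in> column_sets \<alpha> T k}" by (metis card_image)
  then show ?thesis by (simp add: content_def count_image_mset_eq_card_vimage)
qed

lemma column_length_eq_filter: "column_length \<alpha> k = length (filter ((<) k) \<alpha>)"
  by (simp add: column_length_def diagram_def length_filter_conv_card)

text \<open>
  The number of parts equal to \<open>k + 1\<close> is the difference of two consecutive column
  lengths.
\<close>

lemma underlying_partition_iff_column_length:
  assumes "is_composition \<gamma>" "is_partition l"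
  shows "underlying_partition \<gamma> = l \<longleftrightarrow> (\<forall>k. column_length \<gamma> k = column_length l k)"
proof -
  have cnt: "column_length \<alpha> k = count (mset \<alpha>) (Suc k) + column_length \<alpha> (Suc k)" for \<alpha> k
    unfolding column_length_eq_filter by (induction \<alpha>) auto
  have zero: "count (mset \<alpha>) 0 = 0" if "is_composition \<alpha>" for \<alpha>
    using that by (simp only: not_in_iff[symmetric] set_mset_mset) (auto simp: is_composition_def)
  have "sorted (rev l)"
    using assms(2) by (simp add: is_partition_def sorted_wrt_rev)
  then have "underlying_partition \<gamma> = l \<longleftrightarrow> mset \<gamma> = mset l"
    unfolding underlying_partition_def
    by (metis mset_rev mset_sort properties_for_sort rev_rev_ident)
  also have "\<dots> \<longleftrightarrow> (\<forall>k. column_length \<gamma> k = column_length l k)"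
  proof
    assume "mset \<gamma> = mset l"
    then show "\<forall>k. column_length \<gamma> k = column_length l k"
      unfolding column_length_eq_filter by (metis mset_filter size_mset)
  next
    assume eq: "\<forall>k. column_length \<gamma> k = column_length l k"
    show "mset \<gamma> = mset l"
    proof (rule multiset_eqI)
      fix v
      show "count (mset \<gamma>) v = count (mset l) v"
      proof (cases v)
        case 0
        have "is_composition l" using assms(2) by (simp add: is_partition_def)
        show ?thesis unfolding 0 zero[OF \<open>is_composition l\<close>] zero[OF assms(1)] by (rule refl)
      next
        case (Suc k)
        then show ?thesis using cnt[of \<gamma> k] cnt[of l k] eq by simp
      qed
    qed
  qed
  finally show ?thesis .
qed

lemma sum_list_underlying_partition: "sum_list (underlying_partition \<gamma>) = sum_list \<gamma>"
  unfolding underlying_partition_def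
  by (metis mset_rev mset_sort sum_mset_sum_list)

section \<open>Mason's bijection\<close>

text \<open>
  All shapes are treated at once: the shape is part of what the column sets determine.
\<close>

lemma bij_SSCT_dominance_chain:
  "bij_betw (\<lambda>(\<gamma>, T). column_sets \<gamma> T) {(\<gamma>, T). is_composition \<gamma> \<and> T \<in> SSCT \<gamma>}
     {E. dominance_chain E}"
  unfolding bij_betw_def
proof (intro conjI)
  let ?A = "{(\<gamma>, T). is_composition \<gamma> \<and> T \<in> SSCT \<gamma>}"
  have chain: "dominance_chain (column_sets \<gamma> T)" if "is_composition \<gamma>" "T \<in> SSCT \<gamma>" for \<gamma> T
    using dominance_chain_composition_array[OF composition_array_pad[OF that]]
    by (simp add: column_sets_def[abs_def])
  show "inj_on (\<lambda>(\<gamma>, T). column_sets \<gamma> T) ?A"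
  proof (rule inj_onI, clarify)
    fix \<gamma> S \<delta> T
    assume S: "is_composition \<gamma>" "S \<in> SSCT \<gamma>" and T: "is_composition \<delta>" "T \<in> SSCT \<delta>"
      and eq: "column_sets \<gamma> S = column_sets \<delta> T"
    have "pad \<gamma> S = pad \<delta> T"
      using ex1_composition_array[OF chain[OF S]] composition_array_pad[OF S]
        composition_array_pad[OF T] eq
      unfolding column_sets_def by metis
    then show "\<gamma> = \<delta> \<and> S = T"
      using pad_inject[of S \<gamma> T \<delta>] composition_eqI_diagram[OF S(1) T(1)] S(2) T(2)
      by (simp add: SSCT_def)
  qed
  show "(\<lambda>(\<gamma>, T). column_sets \<gamma> T) ` ?A = {E. dominance_chain E}"
  proof (intro set_eqI iffI)
    fix E assume "E \<in> {E. dominance_chain E}"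
    then obtain t where t: "composition_array t" "\<And>k. entries (t k) = E k"
      using ex1_composition_array by blast
    obtain \<gamma> T where "is_composition \<gamma>" "T \<in> SSCT \<gamma>" "pad \<gamma> T = t"
      using tableau_of_composition_array[OF t(1)] .
    moreover from this have "column_sets \<gamma> T = E" using t(2) by (auto simp: column_sets_def)
    ultimately show "E \<in> (\<lambda>(\<gamma>, T). column_sets \<gamma> T) ` ?A" by force
  qed (use chain in auto)
qed

lemma bij_SSRT_dominance_chain:
  assumes l: "is_partition l"
  shows "bij_betw (column_sets l) (SSRT l)
    {E. dominance_chain E \<and> (\<forall>k. card (E k) = column_length l k)}"
  unfolding bij_betw_def
proof (intro conjI)
  have chain: "dominance_chain (column_sets l T)" if "T \<in> SSRT l" for T
    using dominance_chain_reverse_array[OF reverse_array_pad[OF l that]]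
    by (simp add: column_sets_def[abs_def])
  have card: "card (column_sets l T k) = column_length l k" if "T \<in> SSRT l" for T k
    using that column_inj_reverse_array[OF reverse_array_pad[OF l that]]
    by (intro card_column_sets) (auto simp: SSRT_def)
  show "inj_on (column_sets l) (SSRT l)"
  proof (rule inj_onI)
    fix S T assume S: "S \<in> SSRT l" and T: "T \<in> SSRT l"
      and eq: "column_sets l S = column_sets l T"
    have "pad l S = pad l T"
      using ex1_reverse_array[OF chain[OF S]] reverse_array_pad[OF l S]
        reverse_array_pad[OF l T] eq
      unfolding column_sets_def by metis
    then show "S = T" using pad_inject(2)[of S l T l] S T by (simp add: SSRT_def)
  qed
  show "column_sets l ` SSRT l = {E. dominance_chain E \<and> (\<forall>k. card (E k) = column_length l k)}"
  proof (intro set_eqI iffI)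
    fix E assume E: "E \<in> {E. dominance_chain E \<and> (\<forall>k. card (E k) = column_length l k)}"
    then obtain t where t: "reverse_array t" "\<And>k. entries (t k) = E k"
      using ex1_reverse_array by blast
    obtain T where "T \<in> SSRT l" "pad l T = t"
      using tableau_of_reverse_array[OF l t(1)] t(2) E by auto
    moreover from this have "column_sets l T = E" using t(2) by (auto simp: column_sets_def)
    ultimately show "E \<in> column_sets l ` SSRT l" by blast
  qed (use chain card in auto)
qed

lemma finite_compositions_of_partition:
  "finite {\<gamma>. is_composition \<gamma> \<and> underlying_partition \<gamma> = l}"
  by (rule finite_subset[OF _ finite_compositions[of "sum_list l"]])
    (auto simp: sum_list_underlying_partition)

text \<open>
  Both sides count the dominance chains with the column sizes of \<open>l\<close> in which each
  \<open>v\<close> lies in \<open>count m v\<close> sets.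
\<close>

lemma card_SSRT_eq_sum_card_SSCT:
  assumes l: "is_partition l"
  shows "card {T \<in> SSRT l. content l T = m} =
    (\<Sum>\<gamma> | is_composition \<gamma> \<and> underlying_partition \<gamma> = l. card {T \<in> SSCT \<gamma>. content \<gamma> T = m})"
proof (cases "0 \<in># m")
  case True
  then show ?thesis by (simp add: no_tableau_with_zero del: Collect_empty_eq)
next
  case False
  define C where "C = {E. dominance_chain E \<and> (\<forall>k. card (E k) = column_length l k) \<and>
    (\<forall>v>0. card {k. v \<in> E k} = count m v)}"
  have content_iff: "content \<alpha> T = m \<longleftrightarrow> (\<forall>v>0. card {k. v \<in> column_sets \<alpha> T k} = count m v)"
    if T: "T \<in> SSCT \<alpha> \<union> SSRT \<alpha>" and inj: "\<And>k. column_inj (pad \<alpha> T k)" for \<alpha> T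
  proof -
    have PiE: "T \<in> diagram \<alpha> \<rightarrow>\<^sub>E {1..}" using T by (auto simp only: SSCT_def SSRT_def)
    have "count (content \<alpha> T) 0 = count m 0"
      using content_pos[OF T] False by (simp add: not_in_iff)
    then have "content \<alpha> T = m \<longleftrightarrow> (\<forall>v>0. count (content \<alpha> T) v = count m v)"
      unfolding multiset_eq_iff by (metis gr0I)
    then show ?thesis by (simp add: count_content_column_sets[OF PiE inj])
  qed
  have "bij_betw (column_sets l) {T \<in> SSRT l. content l T = m}
      {E \<in> {E. dominance_chain E \<and> (\<forall>k. card (E k) = column_length l k)}.
        \<forall>v>0. card {k. v \<in> E k} = count m v}"
    by (rule bij_betw_Collect[OF bij_SSRT_dominance_chain[OF l]], rule content_iff[symmetric])
      (auto intro: column_inj_reverse_array reverse_array_pad[OF l])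
  then have SSRT: "card {T \<in> SSRT l. content l T = m} = card C"
    by (auto simp: C_def conj_assoc dest: bij_betw_same_card)
  have "bij_betw (\<lambda>(\<gamma>, T). column_sets \<gamma> T)
      {x \<in> {(\<gamma>, T). is_composition \<gamma> \<and> T \<in> SSCT \<gamma>}.
        underlying_partition (fst x) = l \<and> content (fst x) (snd x) = m}
      {E \<in> {E. dominance_chain E}. (\<forall>k. card (E k) = column_length l k) \<and>
        (\<forall>v>0. card {k. v \<in> E k} = count m v)}"
  proof (rule bij_betw_Collect[OF bij_SSCT_dominance_chain], clarify)
    fix \<gamma> T assume \<gamma>: "is_composition \<gamma>" and T: "T \<in> SSCT \<gamma>"
    have inj: "column_inj (pad \<gamma> T k)" for k
      by (rule column_inj_composition_array[OF composition_array_pad[OF \<gamma> T]])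
    have "card (column_sets \<gamma> T k) = column_length \<gamma> k" for k
      using T by (intro card_column_sets inj) (simp add: SSCT_def)
    then show "((\<forall>k. card (column_sets \<gamma> T k) = column_length l k) \<and>
          (\<forall>v>0. card {k. v \<in> column_sets \<gamma> T k} = count m v)) =
        (underlying_partition (fst (\<gamma>, T)) = l \<and> content (fst (\<gamma>, T)) (snd (\<gamma>, T)) = m)"
      using content_iff[of T \<gamma>, OF _ inj] T underlying_partition_iff_column_length[OF \<gamma> l] by simp
  qed
  also have "{x \<in> {(\<gamma>, T). is_composition \<gamma> \<and> T \<in> SSCT \<gamma>}.
        underlying_partition (fst x) = l \<and> content (fst x) (snd x) = m} =
      (SIGMA \<gamma>:{\<gamma>. is_composition \<gamma> \<and> underlying_partition \<gamma> = l}. {T \<in> SSCT \<gamma>. content \<gamma> T = m})"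
    by auto
  finally have "card (SIGMA \<gamma>:{\<gamma>. is_composition \<gamma> \<and> underlying_partition \<gamma> = l}.
      {T \<in> SSCT \<gamma>. content \<gamma> T = m}) = card C"
    unfolding C_def by (simp add: bij_betw_same_card)
  then show ?thesis
    unfolding SSRT
    by (subst (asm) card_SigmaI)
      (auto simp: finite_compositions_of_partition
        finite_fillings_of_content[OF SSCT_extensional])
qed

lemma nc_schur_expansion:
  assumes "is_partition l"
  shows "(nc_schur l :: nat list \<Rightarrow> 'a::field_char_0) =
    (\<Sum>\<gamma> | is_composition \<gamma> \<and> underlying_partition \<gamma> = l. nc_qschur \<gamma>)"
proof
  fix w
  let ?G = "{\<gamma>. is_composition \<gamma> \<and> underlying_partition \<gamma> = l}"
  have "(nc_qschur \<gamma> w :: 'a) = of_nat (comp_fact (mset_composition (mset w)) *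
      card {T \<in> SSCT \<gamma>. content \<gamma> T = mset w})" for \<gamma>
    unfolding nc_qschur_def gen_series_dotted[OF finite_fillings_of_content[OF SSCT_extensional]] ..
  then show "nc_schur l w = (\<Sum>\<gamma>\<in>?G. nc_qschur \<gamma> :: nat list \<Rightarrow> 'a) w"
    by (simp add: nc_schur_apply card_SSRT_eq_sum_card_SSCT[OF assms] sum_fun_apply sum_distrib_left)
qed

section \<open>Triangularity and linear independence\<close>

text \<open>
  The lexicographic order read from the right. It is used for lists of the same length only, where
  it is a strict order.
\<close>

definition reverse_lex_less :: "nat list \<Rightarrow> nat list \<Rightarrow> bool" where
  "reverse_lex_less \<beta> \<alpha> \<longleftrightarrow>
    (\<exists>i<length \<alpha>. \<beta> ! i < \<alpha> ! i \<and> (\<forall>j. i < j \<longrightarrow> j < length \<alpha> \<longrightarrow> \<beta> ! j = \<alpha> ! j))"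

lemma asymp_on_reverse_lex_less:
  "asymp_on {\<gamma>. length \<gamma> = L} reverse_lex_less"
proof (rule asymp_onI, rule notI)
  fix \<alpha> \<beta> :: "nat list"
  assume len: "\<alpha> \<in> {\<gamma>. length \<gamma> = L}" "\<beta> \<in> {\<gamma>. length \<gamma> = L}"
  assume "reverse_lex_less \<alpha> \<beta>"
  then obtain i where i: "i < L" "\<alpha> ! i < \<beta> ! i" "\<And>j. i < j \<Longrightarrow> j < L \<Longrightarrow> \<alpha> ! j = \<beta> ! j"
    using len by (auto simp: reverse_lex_less_def)
  assume "reverse_lex_less \<beta> \<alpha>"
  then obtain k where k: "k < L" "\<beta> ! k < \<alpha> ! k" "\<And>j. k < j \<Longrightarrow> j < L \<Longrightarrow> \<beta> ! j = \<alpha> ! j"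
    using len by (auto simp: reverse_lex_less_def)
  show False using i k by (metis less_asym linorder_neqE_nat less_irrefl)
qed

lemma transp_on_reverse_lex_less:
  "transp_on {\<gamma>. length \<gamma> = L} reverse_lex_less"
proof (rule transp_onI)
  fix \<alpha> \<beta> \<gamma> :: "nat list"
  assume len: "\<alpha> \<in> {\<gamma>. length \<gamma> = L}" "\<beta> \<in> {\<gamma>. length \<gamma> = L}" "\<gamma> \<in> {\<gamma>. length \<gamma> = L}"
  assume "reverse_lex_less \<alpha> \<beta>"
  then obtain i where i: "i < L" "\<alpha> ! i < \<beta> ! i" "\<And>j. i < j \<Longrightarrow> j < L \<Longrightarrow> \<alpha> ! j = \<beta> ! j"
    using len by (auto simp: reverse_lex_less_def)
  assume "reverse_lex_less \<beta> \<gamma>"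
  then obtain k where k: "k < L" "\<beta> ! k < \<gamma> ! k" "\<And>j. k < j \<Longrightarrow> j < L \<Longrightarrow> \<beta> ! j = \<gamma> ! j"
    using len by (auto simp: reverse_lex_less_def)
  have "max i k < L" using i k by simp
  moreover have "\<alpha> ! max i k < \<gamma> ! max i k"
    using i k by (cases i k rule: linorder_cases) (auto simp: max_def)
  moreover have "\<alpha> ! j = \<gamma> ! j" if "max i k < j" "j < L" for j
    using i(3)[of j] k(3)[of j] that by simp
  ultimately show "reverse_lex_less \<alpha> \<gamma>"
    unfolding reverse_lex_less_def using len by (intro exI[of _ "max i k"]) auto
qed

text \<open>
  The tableau with all entries of row \<open>i\<close> equal to \<open>i + 1\<close>.
\<close>

lemma K_number_self_nonzero:
  assumes \<alpha>: "is_composition \<alpha>"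
  shows "K_number \<alpha> \<alpha> \<noteq> 0"
proof -
  define T where "T = restrict (\<lambda>(i, k). Suc i) (diagram \<alpha>)"
  have T: "T (i, k) = Suc i" if "(i, k) \<in> diagram \<alpha>" for i k using that by (simp add: T_def)
  have mem: "T \<in> SSCT \<alpha>"
    unfolding SSCT_def rows_weakly_decreasing_def using T by (auto simp: T_def)
  have "content \<alpha> T = standard_mset \<alpha>"
  proof (rule multiset_eqI)
    fix v
    show "count (content \<alpha> T) v = count (standard_mset \<alpha>) v"
    proof (cases v)
      case 0
      then show ?thesis
        using content_pos[of T \<alpha>] mem standard_mset_properties(1)[OF \<alpha>] by (simp add: not_in_iff)
    next
      case (Suc i)
      have "{c \<in> diagram \<alpha>. T c = Suc i} = (if i < length \<alpha> then Pair i ` {..<\<alpha> ! i} else {})"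
        using T by (auto simp: diagram_def)
      then have "card {c \<in> diagram \<alpha>. T c = Suc i} = (if i < length \<alpha> then \<alpha> ! i else 0)"
        by (simp add: card_image inj_on_def)
      then show ?thesis
        unfolding Suc count_standard_mset[OF \<alpha>] content_def
        by (simp add: count_image_mset_eq_card_vimage)
    qed
  qed
  then have "T \<in> {T \<in> SSCT \<alpha>. content \<alpha> T = standard_mset \<alpha>}" using mem by simp
  then show ?thesis
    unfolding K_number_eq_card_standard[OF \<alpha>]
    using finite_fillings_of_content[OF SSCT_extensional] by (metis card_0_eq empty_iff)
qed

text \<open>
  The first column of a tableau with standard content \<open>\<beta>\<close> has \<open>length
  \<alpha>\<close> distinct entries among \<open>1, \<dots>, length \<beta>\<close>; as
  \<open>\<beta>\<close> is not longer than \<open>\<alpha>\<close>, it is \<open>1, 2,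
  \<dots>\<close>. Rows decrease, so the entry \<open>i + 1\<close> does not occur above row
  \<open>i\<close>; if the rows below are constant, it does not occur there either, and
  \<open>\<beta> ! i \<le> \<alpha> ! i\<close>, with equality only if row \<open>i\<close> is
  constant too. Hence the last position at which \<open>\<alpha>\<close> and
  \<open>\<beta>\<close> differ has the smaller part in \<open>\<beta>\<close>.
\<close>

lemma K_number_triangular:
  assumes \<alpha>: "is_composition \<alpha>" and \<beta>: "is_composition \<beta>"
    and K: "K_number \<alpha> \<beta> \<noteq> 0" and len: "length \<beta> \<le> length \<alpha>" and neq: "\<alpha> \<noteq> \<beta>"
  shows "length \<alpha> = length \<beta>" "reverse_lex_less \<beta> \<alpha>"
proof -
  let ?D = "diagram \<alpha>" and ?L = "length \<alpha>"
  have "{T \<in> SSCT \<alpha>. content \<alpha> T = standard_mset \<beta>} \<noteq> {}"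
    using K unfolding K_number_eq_card_standard[OF \<beta>] by (metis card.empty)
  then obtain T where T: "T \<in> SSCT \<alpha>" and c: "content \<alpha> T = standard_mset \<beta>" by blast
  have rows: "T (i, k) \<le> T (i, 0)" if ik: "(i, k) \<in> ?D" for i k
  proof (cases k)
    case (Suc k')
    have "rows_weakly_decreasing \<alpha> T" using T by (simp add: SSCT_def)
    moreover have "0 < k" "(i, 0) \<in> ?D" using Suc diagram_left[OF ik] by simp_all
    ultimately show ?thesis using ik unfolding rows_weakly_decreasing_def by blast
  qed simp
  have first: "\<And>i j. i < j \<Longrightarrow> (i, 0) \<in> ?D \<Longrightarrow> (j, 0) \<in> ?D \<Longrightarrow> T (i, 0) < T (j, 0)"
    using T unfolding SSCT_def by blast
  have D0: "(i, 0) \<in> ?D \<longleftrightarrow> i < ?L" for i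
    using \<alpha> by (auto simp: diagram_def is_composition_def)
  have vals: "T ` ?D = {1..length \<beta>}"
    using set_content[of \<alpha> T] standard_mset_properties(3)[OF \<beta>] c by simp
  define xs where "xs = map (\<lambda>i. T (i, 0)) [0..<?L]"
  have sorted: "sorted_wrt (<) xs"
    using first D0 by (auto simp: sorted_wrt_iff_nth_less xs_def)
  have sub: "set xs \<subseteq> {1..length \<beta>}"
    using vals D0 unfolding xs_def by auto
  have "card (set xs) = ?L"
    using sorted distinct_card[of xs] by (simp add: strict_sorted_iff) (simp add: xs_def)
  then show leneq: "?L = length \<beta>" using card_mono[OF _ sub] len by simp
  then have "set xs = {1..?L}" using card_subset_eq[OF _ sub] \<open>card (set xs) = ?L\<close> by simp
  then have "set xs = set [1..<Suc ?L]" by (simp only: set_upt atLeastLessThanSuc_atLeastAtMost)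
  then have "xs = [1..<Suc ?L]" by (rule strict_sorted_equal[OF sorted_wrt_upt sorted])
  then have nth: "xs ! i = [1..<Suc ?L] ! i" for i by (rule arg_cong)
  have T0: "T (i, 0) = Suc i" if "i < ?L" for i
    using that nth[of i] by (simp add: xs_def del: upt_Suc)
  have count: "card {c \<in> ?D. T c = Suc i} = \<beta> ! i" if "i < ?L" for i
  proof -
    have "card {c \<in> ?D. T c = Suc i} = count (content \<alpha> T) (Suc i)"
      by (simp add: content_def count_image_mset_eq_card_vimage)
    then show ?thesis using that leneq by (simp add: c count_standard_mset[OF \<beta>])
  qed
  have step: "\<beta> ! i \<le> \<alpha> ! i \<and> (\<beta> ! i = \<alpha> ! i \<longrightarrow> (\<forall>k<\<alpha> ! i. T (i, k) = Suc i))"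
    if i: "i < ?L" and full: "\<And>j k. i < j \<Longrightarrow> j < ?L \<Longrightarrow> k < \<alpha> ! j \<Longrightarrow> T (j, k) = Suc j" for i
  proof -
    have sub: "{c \<in> ?D. T c = Suc i} \<subseteq> Pair i ` {..<\<alpha> ! i}"
    proof clarify
      fix j k assume jk: "(j, k) \<in> ?D" "T (j, k) = Suc i"
      then have j: "j < ?L" "k < \<alpha> ! j" by (auto simp: diagram_def)
      have "Suc i \<le> Suc j" using rows[OF jk(1)] jk(2) T0[OF j(1)] by simp
      moreover have "\<not> i < j" using full[of j k] j jk(2) by auto
      ultimately have "j = i" by simp
      then show "(j, k) \<in> Pair i ` {..<\<alpha> ! i}" using j by simp
    qed
    have card_row: "card (Pair i ` {..<\<alpha> ! i}) = \<alpha> ! i" by (simp add: card_image inj_on_def)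
    have "\<beta> ! i \<le> \<alpha> ! i" using card_mono[OF _ sub] count[OF i] card_row by simp
    moreover have "T (i, k) = Suc i" if "\<beta> ! i = \<alpha> ! i" "k < \<alpha> ! i" for k
    proof -
      have "{c \<in> ?D. T c = Suc i} = Pair i ` {..<\<alpha> ! i}"
        using card_subset_eq[OF _ sub] count[OF i] card_row that(1) by simp
      then show ?thesis using that(2) by blast
    qed
    ultimately show ?thesis by blast
  qed
  define P where "P i \<longleftrightarrow> i < ?L \<and> \<beta> ! i \<noteq> \<alpha> ! i" for i
  have "\<exists>i. P i" using neq leneq unfolding P_def by (metis nth_equalityI)
  then obtain i0 where "P i0" by blast
  define i where "i = (GREATEST i. P i)"
  have bound: "\<And>j. P j \<Longrightarrow> j \<le> ?L" by (simp add: P_def)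
  have "P i" unfolding i_def by (rule GreatestI_nat[of P, OF \<open>P i0\<close> bound])
  then have i: "i < ?L" "\<beta> ! i \<noteq> \<alpha> ! i" by (auto simp: P_def)
  have above: "\<beta> ! j = \<alpha> ! j" if "i < j" "j < ?L" for j
  proof (rule ccontr)
    assume "\<beta> ! j \<noteq> \<alpha> ! j"
    then have "P j" using that by (simp add: P_def)
    then have "j \<le> i" unfolding i_def by (rule Greatest_le_nat[of P, OF _ bound])
    then show False using that by simp
  qed
  have full: "i < j \<Longrightarrow> j < ?L \<Longrightarrow> (\<forall>k<\<alpha> ! j. T (j, k) = Suc j)" for j
  proof (induction j rule: measure_induct_rule[of "\<lambda>j. ?L - j"])
    case (less j)
    have "T (j', k) = Suc j'" if "j < j'" "j' < ?L" "k < \<alpha> ! j'" for j' k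
      using less.IH[of j'] less.prems that by auto
    then show ?case using step[of j] above[of j] less.prems by blast
  qed
  have "\<beta> ! i \<le> \<alpha> ! i" using step[OF i(1)] full by blast
  then show "reverse_lex_less \<beta> \<alpha>"
    unfolding reverse_lex_less_def using i above by (intro exI[of _ i]) auto
qed

lemma comp_fact_pos: "0 < comp_fact \<beta>"
  unfolding comp_fact_def by (induction \<beta>) auto

text \<open>
  Among finitely many compositions take one, \<open>\<beta>\<close>, of minimal length that is
  maximal for the order read from the right. By triangularity no other of the given
  \<open>\<S>\<^sup>R\<^sup>S\<^sub>\<gamma>\<close> contains a word with the content
  \<open>1\<^bsup>\<beta>\<^sub>1\<^esup> 2\<^bsup>\<beta>\<^sub>2\<^esup> \<cdots>\<close>.
\<close>

lemma nc_qschur_independent: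
  "inj_on (nc_qschur :: nat list \<Rightarrow> _ \<Rightarrow> 'a::field_char_0) (Collect is_composition)"
  "series.independent ((nc_qschur :: nat list \<Rightarrow> _ \<Rightarrow> 'a::field_char_0) ` Collect is_composition)"
proof -
  have "\<exists>j\<in>J. \<exists>w. (nc_qschur j w :: 'a) \<noteq> 0 \<and> (\<forall>i\<in>J - {j}. (nc_qschur i w :: 'a) = 0)"
    if J: "finite J" "J \<noteq> {}" "J \<subseteq> Collect is_composition" for J
  proof -
    define L where "L = Min (length ` J)"
    have L: "L \<le> length \<gamma>" if "\<gamma> \<in> J" for \<gamma> using that J by (simp add: L_def)
    let ?J = "{\<gamma> \<in> J. length \<gamma> = L}"
    have "L \<in> length ` J" unfolding L_def using J by (intro Min_in) auto
    then have "?J \<noteq> {}" by auto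
    moreover have "finite ?J" using J by simp
    moreover have "asymp_on ?J reverse_lex_less"
      by (rule asymp_on_subset[OF asymp_on_reverse_lex_less[of L]]) auto
    moreover have "transp_on ?J reverse_lex_less"
      by (rule transp_on_subset[OF transp_on_reverse_lex_less[of L]]) auto
    ultimately obtain \<beta> where \<beta>: "\<beta> \<in> ?J" and
      max: "\<And>\<gamma>. \<gamma> \<in> ?J \<Longrightarrow> \<gamma> \<noteq> \<beta> \<Longrightarrow> \<not> reverse_lex_less \<beta> \<gamma>"
      using Finite_Set.bex_max_element[of ?J reverse_lex_less] by blast
    have comp: "is_composition \<beta>" using \<beta> J by auto
    obtain w where w: "mset w = standard_mset \<beta>" using ex_mset by blast
    have "0 \<notin> set w" using standard_mset_properties(1)[OF comp] w by (metis set_mset_mset)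
    then have app: "(nc_qschur \<gamma> w :: 'a) = of_nat (comp_fact \<beta> * K_number \<gamma> \<beta>)" for \<gamma>
      by (simp add: nc_qschur_apply w standard_mset_properties(2)[OF comp])
    show ?thesis
    proof (intro bexI[of _ \<beta>] exI[of _ w] conjI ballI)
      show "(nc_qschur \<beta> w :: 'a) \<noteq> 0"
        unfolding app using K_number_self_nonzero[OF comp] comp_fact_pos[of \<beta>] by simp
      fix \<gamma> assume \<gamma>: "\<gamma> \<in> J - {\<beta>}"
      have "K_number \<gamma> \<beta> = 0"
      proof (rule ccontr)
        assume K: "K_number \<gamma> \<beta> \<noteq> 0"
        have "is_composition \<gamma>" "length \<beta> \<le> length \<gamma>" "\<gamma> \<noteq> \<beta>" using \<gamma> J \<beta> L by auto
        from K_number_triangular[OF this(1) comp K this(2,3)] max[of \<gamma>] \<gamma> \<beta>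
        show False by simp
      qed
      then show "(nc_qschur \<gamma> w :: 'a) = 0" unfolding app by simp
    qed (use \<beta> in simp)
  qed
  then show "inj_on (nc_qschur :: nat list \<Rightarrow> _ \<Rightarrow> 'a::field_char_0) (Collect is_composition)"
    "series.independent ((nc_qschur :: nat list \<Rightarrow> _ \<Rightarrow> 'a::field_char_0) ` Collect is_composition)"
    using independent_family_if_separated[of "Collect is_composition" "nc_qschur :: nat list \<Rightarrow> _ \<Rightarrow> 'a"]
    by simp_all
qed

section \<open>The forgetful map and its right inverse\<close>

interpretation series_pair: vector_space_pair
  "series_scale :: 'a::field \<Rightarrow> ('m \<Rightarrow> 'a) \<Rightarrow> 'm \<Rightarrow> 'a"
  "series_scale :: 'a::field \<Rightarrow> ('n \<Rightarrow> 'a) \<Rightarrow> 'n \<Rightarrow> 'a"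
  by unfold_locales

lemma linear_chi_tilde:
  "Vector_Spaces.linear series_scale series_scale
    (chi_tilde :: (nat multiset \<Rightarrow> 'a::field_char_0) \<Rightarrow> nat list \<Rightarrow> 'a)"
  unfolding chi_tilde_def by (rule series_pair.linear_construct[OF qsym_M_independent(2)])

lemma chi_tilde_qsym_M:
  assumes "is_composition \<beta>"
  shows "chi_tilde (qsym_M \<beta>) =
    (\<Sum>P | is_set_composition (sum_list \<beta>) P \<and> block_sizes P = \<beta>.
      series_scale (of_nat (comp_fact \<beta>) / fact (sum_list \<beta>))
        (nc_M P :: nat list \<Rightarrow> 'a::field_char_0))"
proof -
  have "qsym_M \<beta> \<in> (qsym_M :: nat list \<Rightarrow> _ \<Rightarrow> 'a) ` Collect is_composition" using assms by simp
  moreover have "the_inv_into (Collect is_composition) qsym_M (qsym_M \<beta> :: _ \<Rightarrow> 'a) = \<beta>"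
    using assms by (intro the_inv_into_f_f qsym_M_independent(1)) simp
  ultimately show ?thesis
    unfolding chi_tilde_def
    by (subst series_pair.construct_basis[OF qsym_M_independent(2)]) (simp_all add: Let_def)
qed

lemma linear_chi:
  "Vector_Spaces.linear series_scale series_scale
    (chi :: (nat list \<Rightarrow> 'a::field) \<Rightarrow> nat multiset \<Rightarrow> 'a)"
  by unfold_locales
    (auto simp: chi_def series_scale_def fun_eq_iff sum.distrib sum_distrib_left)

lemma linear_maps_span:
  assumes f: "Vector_Spaces.linear series_scale series_scale f" and "f ` B \<subseteq> series.span C"
  shows "f \<in> series.span B \<rightarrow> series.span C"
proof -
  have "f ` series.span B = series.span (f ` B)"
    by (rule series_pair.linear_span_image[OF f, symmetric])
  also have "\<dots> \<subseteq> series.span C" by (rule series.span_minimal[OF assms(2) series.subspace_span])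
  finally show ?thesis by blast
qed

lemma chi_in_QSym:
  "(chi :: (nat list \<Rightarrow> 'a::field) \<Rightarrow> nat multiset \<Rightarrow> 'a) \<in> NCQSym \<rightarrow> QSym"
  unfolding NCQSym_def QSym_def
proof (rule linear_maps_span[OF linear_chi], clarify)
  fix n P assume "is_set_composition n P"
  then show "(chi (nc_M P) :: _ \<Rightarrow> 'a) \<in> series.span (qsym_M ` Collect is_composition)"
    by (simp add: chi_nc_M is_composition_block_sizes series.span_base)
qed

lemma chi_tilde_in_NCQSym:
  "(chi_tilde :: (nat multiset \<Rightarrow> 'a::field_char_0) \<Rightarrow> nat list \<Rightarrow> 'a) \<in> QSym \<rightarrow> NCQSym"
  unfolding NCQSym_def QSym_def
proof (rule linear_maps_span[OF linear_chi_tilde], clarify)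
  fix \<beta> assume "is_composition \<beta>"
  then show "(chi_tilde (qsym_M \<beta>) :: _ \<Rightarrow> 'a) \<in> series.span {nc_M P |n P. is_set_composition n P}"
    unfolding chi_tilde_qsym_M[OF \<open>is_composition \<beta>\<close>]
    by (intro series.span_sum series.span_scale series.span_base) blast
qed

text \<open>
  Every \<open>\<^bold>M\<^sub>\<Pi>\<close> with \<open>\<alpha>(\<Pi>) = \<beta>\<close> is sent
  to \<open>M\<^sub>\<beta>\<close>, and there are \<open>n!/\<beta>!\<close> of them, each with
  the weight \<open>\<beta>!/n!\<close>.
\<close>

lemma chi_chi_tilde_qsym_M:
  assumes "is_composition \<beta>"
  shows "chi (chi_tilde (qsym_M \<beta>)) = (qsym_M \<beta> :: _ \<Rightarrow> 'a::field_char_0)"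
proof -
  let ?n = "sum_list \<beta>" and ?c = "of_nat (comp_fact \<beta>) / fact (sum_list \<beta>) :: 'a"
  let ?S = "{P. is_set_composition ?n P \<and> block_sizes P = \<beta>}"
  have "chi (chi_tilde (qsym_M \<beta>)) = (\<Sum>P\<in>?S. chi (series_scale ?c (nc_M P :: _ \<Rightarrow> 'a)))"
    unfolding chi_tilde_qsym_M[OF assms] by (rule series_pair.linear_sum[OF linear_chi])
  also have "\<dots> = (\<Sum>P\<in>?S. series_scale ?c (qsym_M \<beta>))"
    by (intro sum.cong) (auto simp: series_pair.linear_scale[OF linear_chi] chi_nc_M)
  also have "\<dots> = series_scale (of_nat (card ?S) * ?c) (qsym_M \<beta>)"
    by (simp add: fun_eq_iff sum_fun_apply series_scale_def)
  also have "of_nat (card ?S) * ?c = 1"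
    using arg_cong[OF card_set_compositions[OF assms], of "of_nat :: nat \<Rightarrow> 'a"]
    by (simp add: field_simps)
  finally show ?thesis by simp
qed

lemma chi_chi_tilde:
  assumes "f \<in> (QSym :: (nat multiset \<Rightarrow> 'a::field_char_0) set)"
  shows "chi (chi_tilde f) = f"
proof -
  have "Vector_Spaces.linear series_scale series_scale
      ((chi :: (nat list \<Rightarrow> 'a) \<Rightarrow> _) \<circ> chi_tilde)"
    by (rule Vector_Spaces.linear_compose[OF linear_chi_tilde linear_chi])
  from series_pair.linear_eq_on_span[OF this series.linear_id, of "qsym_M ` Collect is_composition" f]
  show ?thesis using assms chi_chi_tilde_qsym_M by (auto simp: QSym_def)
qed

text \<open>
  The weights \<open>\<beta>!/n!\<close> turn the monomial expansion of \<open>n!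
  \<S>\<^sub>\<alpha>\<close> into that of \<open>\<S>\<^sup>R\<^sup>S\<^sub>\<alpha>\<close>.
\<close>

lemma chi_tilde_qschur:
  assumes "sum_list \<alpha> = n"
  shows "chi_tilde (series_scale (fact n) (qschur \<alpha>)) = (nc_qschur \<alpha> :: _ \<Rightarrow> 'a::field_char_0)"
proof -
  let ?S = "{\<beta>. is_composition \<beta> \<and> sum_list \<beta> = n}"
  let ?P = "\<lambda>\<beta>. {P. is_set_composition n P \<and> block_sizes P = \<beta>}"
  note [simp] = series_pair.linear_sum[OF linear_chi_tilde] series_pair.linear_scale[OF linear_chi_tilde]
  have "chi_tilde (series_scale (fact n) (qschur \<alpha>)) =
      (\<Sum>\<beta>\<in>?S. series_scale (fact n * of_nat (K_number \<alpha> \<beta>)) (chi_tilde (qsym_M \<beta>) :: _ \<Rightarrow> 'a))"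
    by (simp add: qschur_expansion[OF assms] series.scale_sum_right)
  also have "\<dots> = (\<Sum>\<beta>\<in>?S. series_scale (of_nat (comp_fact \<beta> * K_number \<alpha> \<beta>)) (\<Sum>P\<in>?P \<beta>. nc_M P))"
    by (intro sum.cong refl)
      (auto simp: chi_tilde_qsym_M simp flip: series.scale_sum_right simp: mult.commute)
  also have "\<dots> = nc_qschur \<alpha>" by (rule nc_qschur_expansion[OF assms, symmetric])
  finally show ?thesis .
qed

theorem theorem5p10:
  fixes l \<alpha> :: "nat list" and n :: nat
  assumes "is_partition l" and "sum_list l = n"
    and "is_composition \<alpha>" and "sum_list \<alpha> = n"
  shows
    "(nc_schur l :: nat list \<Rightarrow> 'a::field_char_0) =
       (\<Sum>\<gamma> | is_composition \<gamma> \<and> underlying_partition \<gamma> = l. nc_qschur \<gamma>)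
     \<and>
     (nc_qschur \<alpha> :: nat list \<Rightarrow> 'a) =
       (\<Sum>\<beta> | is_composition \<beta> \<and> sum_list \<beta> = n.
          series_scale (of_nat (comp_fact \<beta> * K_number \<alpha> \<beta>))
            (\<Sum>P | is_set_composition n P \<and> block_sizes P = \<beta>. nc_M P))
     \<and>
     (inj_on (nc_qschur :: nat list \<Rightarrow> nat list \<Rightarrow> 'a) (Collect is_composition) \<and>
      series.independent
        ((nc_qschur :: nat list \<Rightarrow> nat list \<Rightarrow> 'a) ` Collect is_composition))
     \<and>
     (chi (nc_qschur \<alpha> :: nat list \<Rightarrow> 'a) = series_scale (fact n) (qschur \<alpha>) \<and>
      chi_tilde (series_scale (fact n) (qschur \<alpha>)) = (nc_qschur \<alpha> :: nat list \<Rightarrow> 'a) \<and>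
      (\<forall>m P. is_set_composition m P \<longrightarrow>
         chi (nc_M P :: nat list \<Rightarrow> 'a) = qsym_M (block_sizes P)) \<and>
      (\<forall>\<beta>. is_composition \<beta> \<longrightarrow>
         chi_tilde (qsym_M \<beta>) =
           (\<Sum>P | is_set_composition (sum_list \<beta>) P \<and> block_sizes P = \<beta>.
              series_scale (of_nat (comp_fact \<beta>) / fact (sum_list \<beta>))
                (nc_M P :: nat list \<Rightarrow> 'a))) \<and>
      Vector_Spaces.linear series_scale series_scale
        (chi_tilde :: (nat multiset \<Rightarrow> 'a) \<Rightarrow> nat list \<Rightarrow> 'a) \<and>
      (chi :: (nat list \<Rightarrow> 'a) \<Rightarrow> nat multiset \<Rightarrow> 'a) \<in> NCQSym \<rightarrow> QSym \<and>
      (chi_tilde :: (nat multiset \<Rightarrow> 'a) \<Rightarrow> nat list \<Rightarrow> 'a) \<in> QSym \<rightarrow> NCQSym \<and>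
      (\<forall>f \<in> (QSym :: (nat multiset \<Rightarrow> 'a) set). chi (chi_tilde f) = f))"
  using nc_schur_expansion[OF assms(1)] nc_qschur_expansion[OF assms(4)]
    nc_qschur_independent chi_nc_qschur[OF assms(4)] chi_tilde_qschur[OF assms(4)]
    chi_nc_M chi_tilde_qsym_M linear_chi_tilde chi_in_QSym chi_tilde_in_NCQSym chi_chi_tilde
  by blast

end
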